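(* Let $T$ be a digraph whose underlying undirected graph is a threshold graph, with arbitrary edge orientations. Counting the kernels of $T$ and, if $T$ has a kernel, building one, can be done in time $O(\|T\|)$. Enumerating all kernels of $T$ can be done in time $O(\omega(T)\cdot|T|+\|T\|)$.
   Context: A digraph is a simple, loopless, finite graph with each edge oriented in one direction or in both. A kernel is an independent set $k$ of vertices such that every vertex not in $k$ has an out-neighbour in $k$. $|T|$ is the number of vertices, $\|T\|$ is the number of vertices plus the number of edges, and $\omega(T)$ is the clique number of the underlying graph. A threshold graph is a graph obtained from a single vertex by repeatedly adding one new vertex that is either isolated (disjoint union with a single vertex) or adjacent to all existing vertices (join with a single vertex). *)

theory Defs
  imports "Graph_Theory.Pair_Digraph"
begin

section \<open>Graphs, threshold graphs and kernels\<close>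

text \<open>
  Digraphs are the \<^locale>\<open>pair_digraph\<close>s of the library: finite, loopless, at most one arc from
  \<open>u\<close> to \<open>v\<close>, and possibly both \<open>(u, v)\<close> and \<open>(v, u)\<close>. Such an antiparallel pair is one edge
  (oriented in both directions) of the underlying undirected graph.
\<close>

definition underlying_edges :: "'a pair_pre_digraph \<Rightarrow> 'a set set" where
  "underlying_edges T = {{u, v} | u v. (u, v) \<in> parcs T}"

inductive threshold_graph :: "'a set \<Rightarrow> 'a set set \<Rightarrow> bool" where
  single: "threshold_graph {v} {}"
| isolated: "threshold_graph V E \<Longrightarrow> v \<notin> V \<Longrightarrow> threshold_graph (insert v V) E"
| dominating: "threshold_graph V E \<Longrightarrow> v \<notin> V \<Longrightarrow>
    threshold_graph (insert v V) (E \<union> {{u, v} | u. u \<in> V})"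

definition clique_number :: "'a set \<Rightarrow> 'a set set \<Rightarrow> nat" where
  "clique_number V E = Max (card ` {C. C \<subseteq> V \<and> (\<forall>u\<in>C. \<forall>v\<in>C. u \<noteq> v \<longrightarrow> {u, v} \<in> E)})"

definition kernel :: "'a pair_pre_digraph \<Rightarrow> 'a set \<Rightarrow> bool" where
  "kernel T K \<longleftrightarrow> K \<subseteq> pverts T
     \<and> (\<forall>u\<in>K. \<forall>v\<in>K. {u, v} \<notin> underlying_edges T)
     \<and> (\<forall>u\<in>pverts T - K. \<exists>v\<in>K. (u, v) \<in> parcs T)"

definition order :: "'a pair_pre_digraph \<Rightarrow> nat" where
  "order T = card (pverts T)"

definition total_size :: "'a pair_pre_digraph \<Rightarrow> nat" where
  "total_size T = card (pverts T) + card (underlying_edges T)"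

definition omega :: "'a pair_pre_digraph \<Rightarrow> nat" where
  "omega T = clique_number (pverts T) (underlying_edges T)"

section \<open>Random access machines\<close>

text \<open>
  Running time is measured on a unit-cost random access machine, presented as a small structured
  language over numbered registers and numbered arrays of natural numbers; \<open>Read a e\<close> and
  \<open>Store a e e'\<close> are indirect reading and writing. A program mentions only finitely many registers
  and arrays, and its expressions have fixed size, so charging one unit per executed assignment
  or test is the usual uniform cost measure up to a factor depending on the program only.
  The only arithmetic is successor and predecessor. Hence every number occurring in a run is at most
  the largest number in the input plus a constant (depending on the program) times one plus the
  running time, which excludes hiding work in operations on huge numbers.
\<close>

record store =
  reg :: "nat \<Rightarrow> nat"
  arr :: "nat \<Rightarrow> nat \<Rightarrow> nat"

datatype expr = Const nat | Reg nat | Read nat expr | Succ expr | Pred expr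

datatype test = Less expr expr | Equal expr expr | Not test | And test test

datatype prog =
    Skip
  | Assign nat expr
  | Store nat expr expr
  | Seq prog prog
  | Cond test prog prog
  | While test prog

fun eval_expr :: "expr \<Rightarrow> store \<Rightarrow> nat" where
  "eval_expr (Const n) s = n"
| "eval_expr (Reg r) s = reg s r"
| "eval_expr (Read a e) s = arr s a (eval_expr e s)"
| "eval_expr (Succ e) s = eval_expr e s + 1"
| "eval_expr (Pred e) s = eval_expr e s - 1"

fun eval_test :: "test \<Rightarrow> store \<Rightarrow> bool" where
  "eval_test (Less e e') s \<longleftrightarrow> eval_expr e s < eval_expr e' s"
| "eval_test (Equal e e') s \<longleftrightarrow> eval_expr e s = eval_expr e' s"
| "eval_test (Not b) s \<longleftrightarrow> \<not> eval_test b s"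
| "eval_test (And b b') s \<longleftrightarrow> eval_test b s \<and> eval_test b' s"

text \<open>\<open>exec p s t s'\<close>: started in \<open>s\<close>, program \<open>p\<close> halts in \<open>s'\<close> after time \<open>t\<close>.\<close>

inductive exec :: "prog \<Rightarrow> store \<Rightarrow> nat \<Rightarrow> store \<Rightarrow> bool" where
  Skip: "exec Skip s 1 s"
| Assign: "exec (Assign r e) s 1 (s\<lparr>reg := (reg s)(r := eval_expr e s)\<rparr>)"
| Store: "exec (Store a e e') s 1
    (s\<lparr>arr := (arr s)(a := (arr s a)(eval_expr e s := eval_expr e' s))\<rparr>)"
| Seq: "exec p s t s' \<Longrightarrow> exec q s' t' s'' \<Longrightarrow> exec (Seq p q) s (t + t') s''"
| CondTrue: "eval_test b s \<Longrightarrow> exec p s t s' \<Longrightarrow> exec (Cond b p q) s (1 + t) s'"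
| CondFalse: "\<not> eval_test b s \<Longrightarrow> exec q s t s' \<Longrightarrow> exec (Cond b p q) s (1 + t) s'"
| WhileFalse: "\<not> eval_test b s \<Longrightarrow> exec (While b p) s 1 s"
| WhileTrue: "eval_test b s \<Longrightarrow> exec p s t s' \<Longrightarrow> exec (While b p) s' t' s'' \<Longrightarrow>
    exec (While b p) s (1 + t + t') s''"

inductive_cases exec_SkipE: "exec Skip s t s'"
  and exec_AssignE: "exec (Assign r e) s t s'"
  and exec_StoreE: "exec (Store a e e') s t s'"
  and exec_SeqE: "exec (Seq p q) s t s'"
  and exec_CondE: "exec (Cond b p q) s t s'"
  and exec_WhileE: "exec (While b p) s t s'"

lemma exec_deterministic:
  "exec p s t s' \<Longrightarrow> exec p s u s'' \<Longrightarrow> u = t \<and> s'' = s'"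
proof (induction arbitrary: u s'' rule: exec.induct)
  case (Skip s)
  then show ?case by (rule exec_SkipE) simp
next
  case (Assign r e s)
  then show ?case by (rule exec_AssignE) simp
next
  case (Store a e e' s)
  then show ?case by (rule exec_StoreE) simp
next
  case (Seq p s t s' q t' s'')
  from Seq.prems show ?case by (rule exec_SeqE) (use Seq.IH in fastforce)
next
  case (CondTrue b s p t s' q)
  from CondTrue.prems show ?case by (rule exec_CondE) (use CondTrue.IH CondTrue.hyps(1) in fastforce)+
next
  case (CondFalse b s q t s' p)
  from CondFalse.prems show ?case by (rule exec_CondE) (use CondFalse.IH CondFalse.hyps(1) in fastforce)+
next
  case (WhileFalse b s p)
  from WhileFalse.prems show ?case by (rule exec_WhileE) (simp_all add: WhileFalse.hyps)
next
  case (WhileTrue b s p t s' t' s'')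
  from WhileTrue.prems show ?case by (rule exec_WhileE) (use WhileTrue.IH WhileTrue.hyps(1) in fastforce)+
qed

section \<open>Input and output conventions\<close>

definition holds_list :: "store \<Rightarrow> nat \<Rightarrow> nat \<Rightarrow> nat list \<Rightarrow> bool" where
  "holds_list s r a xs \<longleftrightarrow> reg s r = length xs \<and> (\<forall>i < length xs. arr s a i = xs ! i)"

text \<open>
  Lists of lists are laid out contiguously: array \<open>b\<close> holds their concatenation, and the
  \<open>i\<close>-th list occupies the positions of \<open>b\<close> from \<open>arr s a i\<close> up to (excluding) \<open>arr s a (i + 1)\<close>.
\<close>

definition holds_lists :: "store \<Rightarrow> nat \<Rightarrow> nat \<Rightarrow> nat \<Rightarrow> nat list list \<Rightarrow> bool" where
  "holds_lists s r a b xss \<longleftrightarrow> reg s r = length xss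
     \<and> (\<forall>i \<le> length xss. arr s a i = length (concat (take i xss)))
     \<and> (\<forall>i < length (concat xss). arr s b i = concat xss ! i)"

text \<open>
  The initial store holding \<open>xss\<close> in register 0 and arrays 0 and 1, all other memory
  cells being 0.
\<close>

definition input_store :: "nat list list \<Rightarrow> store" where
  "input_store xss = \<lparr>
     reg = (\<lambda>_. 0)(0 := length xss),
     arr = (\<lambda>_ _. 0)
       (0 := (\<lambda>i. if i \<le> length xss then length (concat (take i xss)) else 0),
        1 := (\<lambda>i. if i < length (concat xss) then concat xss ! i else 0))\<rparr>"

text \<open>
  A digraph is given to a program by its lists of out-neighbours, in any order. As machine data,
  the vertices are numbered from 0.
\<close>

definition out_lists :: "nat pair_pre_digraph \<Rightarrow> nat list list \<Rightarrow> bool" where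
  "out_lists T adj \<longleftrightarrow> pverts T = {..<length adj}
     \<and> (\<forall>u < length adj. distinct (adj ! u) \<and> set (adj ! u) = {v. (u, v) \<in> parcs T})"

text \<open>
  The count is left in register 0; a kernel, if there is one, in register 1 (number of vertices)
  and array 0.
\<close>

definition kernel_counted_and_built :: "nat pair_pre_digraph \<Rightarrow> store \<Rightarrow> bool" where
  "kernel_counted_and_built T s \<longleftrightarrow> reg s 0 = card {K. kernel T K}
     \<and> ((\<exists>K. kernel T K) \<longrightarrow>
          (\<exists>xs. holds_list s 1 0 xs \<and> distinct xs \<and> kernel T (set xs)))"

text \<open>Each kernel is written out in full, exactly once.\<close>

definition kernels_enumerated :: "nat pair_pre_digraph \<Rightarrow> store \<Rightarrow> bool" where
  "kernels_enumerated T s \<longleftrightarrow>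
     (\<exists>xss. holds_lists s 0 0 1 xss \<and> (\<forall>xs \<in> set xss. distinct xs)
        \<and> distinct (map set xss) \<and> set (map set xss) = {K. kernel T K})"

end

theory Submission
  imports Defs
begin

text \<open>
  List the vertices in the order in which the threshold graph is built. Appending an isolated vertex
  \<open>v\<close> adds \<open>v\<close> to every kernel. Appending a dominating vertex \<open>v\<close> keeps the kernels that contain an
  out-neighbour of \<open>v\<close>, and creates \<open>{v}\<close> if all earlier vertices point to \<open>v\<close>. Hence a kernel is determined by
  its dominating vertex, if it has one, and there are at most \<open>\<omega> + 1\<close> candidates. Scanning all earlier
  positions backwards when a dominating vertex is processed updates all candidates at once; this
  costs no more than the number of edges to these positions.

  The sequence is found from its end with buckets of vertices by undirected degree: if \<open>r\<close> vertices remain and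
  \<open>d\<close> dominating ones have been removed, the isolated vertices are those of degree \<open>d\<close>, the dominating
  ones those of degree \<open>r - 1 + d\<close>.
\<close>

subsection \<open>Timed execution\<close>

text \<open>While the sequence is processed, candidates are never stored as sets. An isolated vertex
  enters all of them, which needs no work beyond noting that no candidate starts there, so one
  survival flag per candidate suffices.

  The shape of the candidates forces the direction of the scan. The one starting at position
  \<open>j - 1\<close> consists of that vertex and the isolated positions from \<open>j\<close> on.
  Going downwards, a single bit, whether an isolated out-neighbour has been met, therefore decides
  each candidate at the moment its start is reached.

  Two obstacles come from the input format. The scan needs arc tests in constant time, but only
  lists are given; marking the out- and in-neighbours of the current vertex provides them. The lists
  contain arcs, whereas eliminating by degree needs undirected degrees; the same marks prevent
  antiparallel pairs from being counted twice.

  Writing out a candidate takes time linear in the number of vertices. The one candidate beyond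
  \<open>\<omega>\<close> is paid for by the summand \<open>\<parallel>T\<parallel>\<close>.\<close>

definition runs :: "prog \<Rightarrow> store \<Rightarrow> (nat \<Rightarrow> store \<Rightarrow> bool) \<Rightarrow> bool" where
  "runs p s Q \<longleftrightarrow> (\<exists>t s'. exec p s t s' \<and> Q t s')"

lemma runs_mono: "runs p s Q \<Longrightarrow> (\<And>t s'. Q t s' \<Longrightarrow> R t s') \<Longrightarrow> runs p s R"
  unfolding runs_def by blast

lemma exec_Skip_iff: "exec Skip s t s' \<longleftrightarrow> t = 1 \<and> s' = s"
  using exec.Skip[of s] by (auto elim: exec_SkipE)

lemma exec_Assign_iff:
  "exec (Assign r e) s t s' \<longleftrightarrow> t = 1 \<and> s' = s\<lparr>reg := (reg s)(r := eval_expr e s)\<rparr>"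
  using exec.Assign[of r e s] by (auto elim: exec_AssignE)

lemma exec_Store_iff:
  "exec (Store a e e') s t s' \<longleftrightarrow>
    t = 1 \<and> s' = s\<lparr>arr := (arr s)(a := (arr s a)(eval_expr e s := eval_expr e' s))\<rparr>"
  using exec.Store[of a e e' s] by (auto elim: exec_StoreE)

lemma exec_Seq_iff:
  "exec (Seq p q) s t s'' \<longleftrightarrow> (\<exists>u u' s'. t = u + u' \<and> exec p s u s' \<and> exec q s' u' s'')"
  by (blast elim: exec_SeqE intro: exec.Seq)

lemma exec_Cond_iff:
  "exec (Cond b p q) s t s' \<longleftrightarrow> (\<exists>u. t = 1 + u \<and> exec (if eval_test b s then p else q) s u s')"
  by (auto elim: exec_CondE intro: exec.CondTrue exec.CondFalse simp del: One_nat_def plus_1_eq_Suc)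

lemma exec_While_iff:
  "exec (While b p) s t s'' \<longleftrightarrow>
    (if eval_test b s then \<exists>u u' s'. t = 1 + u + u' \<and> exec p s u s' \<and> exec (While b p) s' u' s''
     else t = 1 \<and> s'' = s)" (is "?l \<longleftrightarrow> ?r")
proof
  show "?l \<Longrightarrow> ?r" by (erule exec_WhileE) auto
  show "?r \<Longrightarrow> ?l"
    using exec.WhileTrue[of b s p _ _ _ s''] exec.WhileFalse[of b s p] by (metis (no_types))
qed

text \<open>Stated as equations, these rules let simplification execute straight-line code. Since
  execution is deterministic (\<open>exec_deterministic\<close>), the existential in
  \<open>runs\<close> amounts to total correctness with a time bound.\<close>

lemma runs_Skip [simp]: "runs Skip s Q \<longleftrightarrow> Q 1 s"
  by (simp add: runs_def exec_Skip_iff)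

lemma runs_Assign [simp]:
  "runs (Assign r e) s Q \<longleftrightarrow> Q 1 (s\<lparr>reg := (reg s)(r := eval_expr e s)\<rparr>)"
  by (simp add: runs_def exec_Assign_iff)

lemma runs_Store [simp]:
  "runs (Store a e e') s Q \<longleftrightarrow>
    Q 1 (s\<lparr>arr := (arr s)(a := (arr s a)(eval_expr e s := eval_expr e' s))\<rparr>)"
  by (simp add: runs_def exec_Store_iff)

lemma runs_Seq [simp]:
  "runs (Seq p q) s Q \<longleftrightarrow> runs p s (\<lambda>t s'. runs q s' (\<lambda>t'. Q (t + t')))"
  by (auto simp: runs_def exec_Seq_iff) blast

lemma runs_Cond [simp]:
  "runs (Cond b p q) s Q \<longleftrightarrow>
    (if eval_test b s then runs p s (\<lambda>t. Q (1 + t)) else runs q s (\<lambda>t. Q (1 + t)))"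
  by (auto simp: runs_def exec_Cond_iff)

text \<open>Not a simp rule: as a rewrite rule it could unfold the loop for ever.\<close>

lemma runs_While:
  "runs (While b p) s Q \<longleftrightarrow>
    (if eval_test b s then runs p s (\<lambda>t s'. runs (While b p) s' (\<lambda>t'. Q (1 + t + t'))) else Q 1 s)"
  unfolding runs_def by (subst exec_While_iff) (simp, blast)

section \<open>Frame conditions and loop rules\<close>

fun written_regs :: "prog \<Rightarrow> nat set" where
  "written_regs (Assign r e) = {r}"
| "written_regs (Seq p q) = written_regs p \<union> written_regs q"
| "written_regs (Cond b p q) = written_regs p \<union> written_regs q"
| "written_regs (While b p) = written_regs p"
| "written_regs _ = {}"

fun written_arrs :: "prog \<Rightarrow> nat set" where
  "written_arrs (Store a e e') = {a}"
| "written_arrs (Seq p q) = written_arrs p \<union> written_arrs q"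
| "written_arrs (Cond b p q) = written_arrs p \<union> written_arrs q"
| "written_arrs (While b p) = written_arrs p"
| "written_arrs _ = {}"

definition unchanged :: "prog \<Rightarrow> store \<Rightarrow> store \<Rightarrow> bool" where
  "unchanged p s s' \<longleftrightarrow> (\<forall>r. r \<notin> written_regs p \<longrightarrow> reg s' r = reg s r)
     \<and> (\<forall>a. a \<notin> written_arrs p \<longrightarrow> arr s' a = arr s a)"

lemma unchanged_refl [simp]: "unchanged p s s"
  by (simp add: unchanged_def)

lemma unchanged_trans: "unchanged p s s' \<Longrightarrow> unchanged p s' s'' \<Longrightarrow> unchanged p s s''"
  by (simp add: unchanged_def)

lemma exec_unchanged: "exec p s t s' \<Longrightarrow> unchanged p s s'"
  by (induction rule: exec.induct) (auto simp: unchanged_def)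

text \<open>The frame comes for free in every postcondition, so specifications and invariants need
  to mention only what a program writes.\<close>

lemma runs_unchanged: "runs p s (\<lambda>t s'. unchanged p s s' \<longrightarrow> Q t s') \<Longrightarrow> runs p s Q"
  unfolding runs_def using exec_unchanged by blast

text \<open>Each round pays one unit for its test on top of \<open>f k\<close>, and the failing last
  test pays one more. The frame refers to the state before the loop, so facts about untouched memory
  stay out of \<open>I\<close>.\<close>

lemma runs_While_down:
  assumes "I b s"
    and step: "\<And>k s'. k < b \<Longrightarrow> I (Suc k) s' \<Longrightarrow> unchanged p s s' \<Longrightarrow>
      eval_test c s' \<and> runs p s' (\<lambda>t s''. I k s'' \<and> t \<le> f k)"
    and exit: "\<And>s'. I 0 s' \<Longrightarrow> unchanged p s s' \<Longrightarrow> \<not> eval_test c s'"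
    and post: "\<And>t s'. I 0 s' \<Longrightarrow> unchanged p s s' \<Longrightarrow> t \<le> (\<Sum>k<b. f k + 1) + 1 \<Longrightarrow> Q t s'"
  shows "runs (While c p) s Q"
proof -
  have "runs (While c p) s' (\<lambda>t s''. I 0 s'' \<and> unchanged p s s'' \<and> t \<le> (\<Sum>k<m. f k + 1) + 1)"
    if "I m s'" "unchanged p s s'" "m \<le> b" for m s'
    using that
  proof (induction m arbitrary: s')
    case 0
    then show ?case using exit by (subst runs_While) auto
  next
    case (Suc k)
    have "eval_test c s'" and r: "runs p s' (\<lambda>t s''. I k s'' \<and> t \<le> f k)"
      using step[of k s'] Suc.prems by auto
    have "runs p s' (\<lambda>t s''. runs (While c p) s'' (\<lambda>t' s'. I 0 s' \<and> unchanged p s s' \<and>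
        1 + t + t' \<le> (\<Sum>k<Suc k. f k + 1) + 1))"
    proof (rule runs_unchanged, rule runs_mono[OF r], intro impI)
      fix t s'' assume *: "I k s'' \<and> t \<le> f k" "unchanged p s' s''"
      then have "unchanged p s s''" using Suc.prems unchanged_trans by blast
      then have "runs (While c p) s'' (\<lambda>t s''. I 0 s'' \<and> unchanged p s s'' \<and> t \<le> (\<Sum>k<k. f k + 1) + 1)"
        using Suc.IH[of s''] Suc.prems * by simp
      then show "runs (While c p) s'' (\<lambda>t' s'. I 0 s' \<and> unchanged p s s' \<and>
          1 + t + t' \<le> (\<Sum>k<Suc k. f k + 1) + 1)"
        by (rule runs_mono) (use * in auto)
    qed
    then show ?case using \<open>eval_test c s'\<close> by (subst runs_While) simp
  qed
  from this[of b s] assms(1) post show ?thesis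
    by (auto elim!: runs_mono)
qed

lemma runs_While_up:
  assumes "I a s" "a \<le> b"
    and step: "\<And>k s'. a \<le> k \<Longrightarrow> k < b \<Longrightarrow> I k s' \<Longrightarrow> unchanged p s s' \<Longrightarrow>
      eval_test c s' \<and> runs p s' (\<lambda>t s''. I (Suc k) s'' \<and> t \<le> f k)"
    and exit: "\<And>s'. I b s' \<Longrightarrow> unchanged p s s' \<Longrightarrow> \<not> eval_test c s'"
    and post: "\<And>t s'. I b s' \<Longrightarrow> unchanged p s s' \<Longrightarrow> t \<le> (\<Sum>k=a..<b. f k + 1) + 1 \<Longrightarrow> Q t s'"
  shows "runs (While c p) s Q"
\<comment> \<open>The countdown index is the number of rounds left, hence the reversal
  \<open>b - k\<close>.\<close>
proof (rule runs_While_down[where I = "\<lambda>k. I (b - k)" and b = "b - a" and f = "\<lambda>k. f (b - Suc k)"])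
  show "I (b - (b - a)) s" using assms(1,2) by simp
  fix k s' assume k: "k < b - a" and s': "I (b - Suc k) s'" "unchanged p s s'"
  then have "Suc (b - Suc k) = b - k" by simp
  with step[OF _ _ s'] k show "eval_test c s' \<and> runs p s' (\<lambda>t s''. I (b - k) s'' \<and> t \<le> f (b - Suc k))"
    by simp
next
  show "\<not> eval_test c s'" if "I (b - 0) s'" "unchanged p s s'" for s'
    using that exit by simp
  have eq: "(\<Sum>k<b - a. f (b - Suc k) + 1) = (\<Sum>k=a..<b. f k + 1)"
    by (rule sum.reindex_bij_witness[of _ "\<lambda>k. b - Suc k" "\<lambda>k. b - Suc k"]) auto
  show "Q t s'" if "I (b - 0) s'" "unchanged p s s'" "t \<le> (\<Sum>k<b - a. f (b - Suc k) + 1) + 1" for t s'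
    using that post unfolding eq by simp
qed

subsection \<open>Elimination orders\<close>

locale finite_digraph =
  fixes n :: nat and A :: "nat \<Rightarrow> nat \<Rightarrow> bool"
  assumes bounded: "A u v \<Longrightarrow> u < n \<and> v < n"
    and irrefl: "\<not> A u u"
begin

definition adjacent :: "nat \<Rightarrow> nat \<Rightarrow> bool" where
  "adjacent u v \<longleftrightarrow> A u v \<or> A v u"

definition deg :: "nat \<Rightarrow> nat" where
  "deg u = card {v. v < n \<and> adjacent u v}"

definition edges :: "nat set set" where
  "edges = {{u, v} | u v. A u v}"

lemma adjacent_sym: "adjacent u v \<longleftrightarrow> adjacent v u"
  by (auto simp: adjacent_def)

lemma not_adjacent_self [simp]: "\<not> adjacent u u"
  by (simp add: adjacent_def irrefl)

lemma edge_iff_adjacent: "{u, v} \<in> edges \<longleftrightarrow> adjacent u v"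
  by (auto simp: edges_def adjacent_def doubleton_eq_iff)

lemma finite_arcs: "finite {(u, v). A u v}"
  by (rule finite_subset[of _ "{..<n} \<times> {..<n}"]) (use bounded in auto)

lemma finite_edges: "finite edges"
proof -
  have "edges = (\<lambda>(u, v). {u, v}) ` {(u, v). A u v}"
    by (auto simp: edges_def image_def)
  then show ?thesis using finite_arcs by simp
qed

text \<open>The arcs with \<open>u < v\<close> and those with \<open>v < u\<close> each inject into
  the edges. This links the length of the input, which counts arcs, to a size that counts
  edges.\<close>

lemma card_arcs_le: "card {(u, v). A u v} \<le> 2 * card edges"
proof -
  have "card {(u, v). A u v \<and> u < v} \<le> card edges"
    by (rule card_inj_on_le[where f = "\<lambda>(u, v). {u, v}"])
      (auto simp: inj_on_def doubleton_eq_iff edges_def finite_edges[unfolded edges_def])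
  moreover have "card {(u, v). A u v \<and> v < u} \<le> card edges"
    by (rule card_inj_on_le[where f = "\<lambda>(u, v). {u, v}"])
      (auto simp: inj_on_def doubleton_eq_iff edges_def finite_edges[unfolded edges_def])
  moreover have "{(u, v). A u v} = {(u, v). A u v \<and> u < v} \<union> {(u, v). A u v \<and> v < u}"
    using irrefl by (auto, metis linorder_neqE_nat)
  ultimately show ?thesis
    using card_Un_le[of "{(u, v). A u v \<and> u < v}" "{(u, v). A u v \<and> v < u}"] by simp
qed

definition remaining :: "(nat \<Rightarrow> nat) \<Rightarrow> nat \<Rightarrow> nat set" where
  "remaining ord r = {..<n} - ord ` {r..<n}"

text \<open>
  Positions are filled from \<open>n - 1\<close> down to \<open>r\<close>; \<open>joined k\<close> records that the vertex \<open>ord k\<close> was added as a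
  dominating one.
\<close>

definition eliminates :: "(nat \<Rightarrow> nat) \<Rightarrow> (nat \<Rightarrow> bool) \<Rightarrow> nat \<Rightarrow> bool" where
  "eliminates ord joined r \<longleftrightarrow> r \<le> n \<and> inj_on ord {r..<n} \<and> ord ` {r..<n} \<subseteq> {..<n}
     \<and> (\<forall>k. r \<le> k \<and> k < n \<longrightarrow> (\<forall>u\<in>remaining ord k. adjacent u (ord k) \<longleftrightarrow> joined k))"

lemma finite_remaining [simp]: "finite (remaining ord r)"
  by (simp add: remaining_def)

lemma card_remaining: "eliminates ord joined r \<Longrightarrow> card (remaining ord r) = r"
  unfolding remaining_def eliminates_def
  by (simp add: card_Diff_subset card_image)

lemma eliminates_n: "eliminates ord joined n"
  by (auto simp: eliminates_def)

lemma remaining_Suc: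
  assumes "r < n" "\<And>k. r < k \<Longrightarrow> ord' k = ord k"
  shows "remaining ord' r = remaining ord (Suc r) - {ord' r}"
proof -
  have "{r..<n} = insert r {Suc r..<n}" using assms by auto
  moreover have "ord' ` {Suc r..<n} = ord ` {Suc r..<n}"
    using assms by (intro image_cong) auto
  ultimately show ?thesis by (auto simp: remaining_def)
qed

lemma remaining_cong:
  "(\<And>k. r \<le> k \<Longrightarrow> ord' k = ord k) \<Longrightarrow> remaining ord' r = remaining ord r"
  unfolding remaining_def by (metis (no_types, lifting) atLeastLessThan_iff image_cong)

text \<open>The new functions agree with the old ones above \<open>r\<close> and are arbitrary below
  it, so contents of arrays can be inserted without knowing their unfilled cells.\<close>

lemma eliminates_step:
  assumes "eliminates ord joined (Suc r)" "ord' r \<in> remaining ord (Suc r)"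
    and "\<And>u. u \<in> remaining ord (Suc r) \<Longrightarrow> u \<noteq> ord' r \<Longrightarrow> adjacent u (ord' r) \<longleftrightarrow> joined' r"
    and same: "\<And>k. r < k \<Longrightarrow> ord' k = ord k \<and> joined' k = joined k"
  shows "eliminates ord' joined' r"
proof -
  have r: "r < n" using assms(1) by (simp add: eliminates_def)
  have ins: "{r..<n} = insert r {Suc r..<n}" using r by auto
  have im: "ord' ` {Suc r..<n} = ord ` {Suc r..<n}"
    using same by (intro image_cong) auto
  have "inj_on ord' {Suc r..<n} \<longleftrightarrow> inj_on ord {Suc r..<n}"
    using same by (intro inj_on_cong) auto
  then have inj: "inj_on ord' {r..<n}"
    using assms(1,2) im unfolding ins eliminates_def remaining_def by auto
  have "ord' ` {r..<n} \<subseteq> {..<n}"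
    using assms(1,2) im unfolding ins eliminates_def remaining_def by auto
  moreover have "adjacent u (ord' k) \<longleftrightarrow> joined' k" if k: "r \<le> k" "k < n" and u: "u \<in> remaining ord' k" for k u
  proof (cases "k = r")
    case True
    then show ?thesis
      using assms(3)[of u] u r remaining_Suc[of r ord' ord] same by auto
  next
    case False
    then have "remaining ord' k = remaining ord k"
      using same k by (intro remaining_cong) auto
    then show ?thesis
      using False k u same[of k] assms(1) by (auto simp: eliminates_def)
  qed
  ultimately show ?thesis using inj r by (simp add: eliminates_def)
qed

definition dominating_after :: "(nat \<Rightarrow> bool) \<Rightarrow> nat \<Rightarrow> nat" where
  "dominating_after joined r = card {k. r \<le> k \<and> k < n \<and> joined k}"

lemma dominating_after_n [simp]: "dominating_after joined n = 0"
  by (auto simp: dominating_after_def)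

lemma dominating_after_Suc:
  assumes "r < n" "\<And>k. r < k \<Longrightarrow> joined' k = joined k"
  shows "dominating_after joined' r = (if joined' r then Suc (dominating_after joined (Suc r)) else dominating_after joined (Suc r))"
proof -
  have "{k. r \<le> k \<and> k < n \<and> joined' k} =
    (if joined' r then insert r {k. Suc r \<le> k \<and> k < n \<and> joined k} else {k. Suc r \<le> k \<and> k < n \<and> joined k})"
    using assms by (auto simp: Suc_le_eq order_le_less)
  then show ?thesis by (simp add: dominating_after_def)
qed

text \<open>A remaining vertex is adjacent to every removed dominating vertex and to no removed
  isolated one. Hence the degrees in the whole graph reveal the degrees among the remaining
  vertices, and no vertex ever has to change its bucket.\<close>

lemma deg_remaining:
  assumes "eliminates ord joined r" "u \<in> remaining ord r"
  shows "deg u = dominating_after joined r + card {v \<in> remaining ord r. adjacent u v}"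
proof -
  have *: "adjacent u (ord k) \<longleftrightarrow> joined k" if "r \<le> k" "k < n" for k
  proof -
    have "u \<in> remaining ord k" using assms(2) that by (auto simp: remaining_def)
    then show ?thesis using assms(1) that by (auto simp: eliminates_def)
  qed
  have split: "v < n \<longleftrightarrow> v \<in> remaining ord r \<or> v \<in> ord ` {r..<n}" for v
    using assms(1) by (auto simp: remaining_def eliminates_def)
  have "{v. v < n \<and> adjacent u v} =
      {v \<in> remaining ord r. adjacent u v} \<union> {v \<in> ord ` {r..<n}. adjacent u v}"
    using split by blast
  also have "{v \<in> ord ` {r..<n}. adjacent u v} = ord ` {k. r \<le> k \<and> k < n \<and> joined k}"
    by (auto simp: *)
  finally have "{v. v < n \<and> adjacent u v} =
      ord ` {k. r \<le> k \<and> k < n \<and> joined k} \<union> {v \<in> remaining ord r. adjacent u v}"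
    by (simp only: Un_commute)
  moreover have "card (ord ` {k. r \<le> k \<and> k < n \<and> joined k}) = dominating_after joined r"
    unfolding dominating_after_def
    by (rule card_image, rule inj_on_subset[of _ "{r..<n}"]) (use assms(1) in \<open>auto simp: eliminates_def\<close>)
  moreover have "ord ` {k. r \<le> k \<and> k < n \<and> joined k} \<inter> {v \<in> remaining ord r. adjacent u v} = {}"
    by (auto simp: remaining_def)
  ultimately show ?thesis
    by (simp add: deg_def card_Un_disjoint)
qed

lemma isolated_if_deg:
  assumes "eliminates ord joined r" "u \<in> remaining ord r" "deg u = dominating_after joined r"
    and "v \<in> remaining ord r"
  shows "\<not> adjacent v u"
  using deg_remaining[OF assms(1,2)] assms(3,4) adjacent_sym[of u v] by auto

text \<open>\<open>Suc r\<close> vertices remain, so having \<open>r\<close> neighbours among them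
  means being adjacent to all others.\<close>

lemma dominating_if_deg:
  assumes "eliminates ord joined (Suc r)" "u \<in> remaining ord (Suc r)"
    and "deg u = r + dominating_after joined (Suc r)"
    and "v \<in> remaining ord (Suc r)" "v \<noteq> u"
  shows "adjacent v u"
proof -
  have "card {v \<in> remaining ord (Suc r). adjacent u v} = card (remaining ord (Suc r) - {u})"
    using deg_remaining[OF assms(1,2)] assms(3) card_remaining[OF assms(1)] assms(2) by simp
  then have "{v \<in> remaining ord (Suc r). adjacent u v} = remaining ord (Suc r) - {u}"
    by (intro card_subset_eq) auto
  then show ?thesis using assms(4,5) adjacent_sym[of u v] by auto
qed

end

text \<open>A hereditary form of being a threshold graph: it applies to whatever set the elimination
  has left, without reference to a particular construction.\<close>

locale threshold_digraph = finite_digraph +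
  assumes isolated_or_dominating: "S \<subseteq> {..<n} \<Longrightarrow> S \<noteq> {} \<Longrightarrow>
    \<exists>v\<in>S. (\<forall>u\<in>S. \<not> adjacent u v) \<or> (\<forall>u\<in>S - {v}. adjacent u v)"
begin

lemma ex_dominating_deg:
  assumes "eliminates ord joined (Suc r)"
    and "\<And>u. u \<in> remaining ord (Suc r) \<Longrightarrow> deg u \<noteq> dominating_after joined (Suc r)"
  shows "\<exists>u\<in>remaining ord (Suc r). deg u = r + dominating_after joined (Suc r)"
proof -
  have "remaining ord (Suc r) \<noteq> {}"
    using card_remaining[OF assms(1)] by auto
  then obtain v where v: "v \<in> remaining ord (Suc r)"
    and cases: "(\<forall>u\<in>remaining ord (Suc r). \<not> adjacent u v) \<or> (\<forall>u\<in>remaining ord (Suc r) - {v}. adjacent u v)"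
    using isolated_or_dominating[of "remaining ord (Suc r)"] by (auto simp: remaining_def)
  note deg = deg_remaining[OF assms(1) v]
  from cases show ?thesis
  proof
    assume "\<forall>u\<in>remaining ord (Suc r). \<not> adjacent u v"
    then have "{u \<in> remaining ord (Suc r). adjacent v u} = {}" by (auto simp: adjacent_sym)
    then show ?thesis using deg assms(2)[OF v] by simp
  next
    assume "\<forall>u\<in>remaining ord (Suc r) - {v}. adjacent u v"
    then have "{u \<in> remaining ord (Suc r). adjacent v u} = remaining ord (Suc r) - {v}"
      by (auto simp: adjacent_sym)
    then show ?thesis using deg v card_remaining[OF assms(1)]
      by (intro bexI[of _ v]) (auto simp: add.commute)
  qed
qed

end

subsection \<open>Kernels along a construction sequence\<close>

text \<open>
  Candidate \<open>0\<close> consists of all isolated vertices of the sequence; candidate \<open>j > 0\<close> starts with the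
  dominating vertex at position \<open>j - 1\<close>. \<open>cand ord joined j k\<close> is its part within the first \<open>k\<close> positions.
\<close>

definition cand :: "(nat \<Rightarrow> nat) \<Rightarrow> (nat \<Rightarrow> bool) \<Rightarrow> nat \<Rightarrow> nat \<Rightarrow> nat set" where
  "cand ord joined j k = (if j = 0 then {} else {ord (j - 1)}) \<union> ord ` {p. j \<le> p \<and> p < k \<and> \<not> joined p}"

definition cand_list :: "(nat \<Rightarrow> nat) \<Rightarrow> (nat \<Rightarrow> bool) \<Rightarrow> nat \<Rightarrow> nat \<Rightarrow> nat list" where
  "cand_list ord joined n j = (if j = 0 then [] else [ord (j - 1)]) @ map ord (filter (\<lambda>p. \<not> joined p) [j..<n])"

text \<open>For a dominating \<open>q\<close> only the part of the candidate before \<open>q\<close>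
  matters: whatever enters later is isolated when appended and so not adjacent to
  \<open>ord q\<close>. A candidate that has failed thus never recovers.\<close>

definition alive :: "(nat \<Rightarrow> nat \<Rightarrow> bool) \<Rightarrow> (nat \<Rightarrow> nat) \<Rightarrow> (nat \<Rightarrow> bool) \<Rightarrow> nat \<Rightarrow> nat \<Rightarrow> bool" where
  "alive A ord joined j k \<longleftrightarrow> (j \<noteq> 0 \<longrightarrow> joined (j - 1) \<and> (\<forall>p<j - 1. A (ord p) (ord (j - 1))))
     \<and> (\<forall>q. j \<le> q \<and> q < k \<and> joined q \<longrightarrow> (\<exists>w\<in>cand ord joined j q. A (ord q) w))"

text \<open>Candidate \<open>j\<close> starts at position \<open>j - 1\<close>, so indices run up to
  \<open>n\<close> inclusive.\<close>

definition alive_list :: "(nat \<Rightarrow> nat \<Rightarrow> bool) \<Rightarrow> (nat \<Rightarrow> nat) \<Rightarrow> (nat \<Rightarrow> bool) \<Rightarrow> nat \<Rightarrow> nat list" where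
  "alive_list A ord joined n = filter (\<lambda>j. alive A ord joined j n) [0..<Suc n]"

lemma in_alive_list_iff [simp]: "j \<in> set (alive_list A ord joined n) \<longleftrightarrow> j \<le> n \<and> alive A ord joined j n"
  by (auto simp: alive_list_def less_Suc_eq_le simp del: upt_Suc)

lemma alive_0_0 [simp]: "alive A ord joined 0 0"
  by (simp add: alive_def)

lemma alive_Suc:
  "j \<le> k \<Longrightarrow> alive A ord joined j (Suc k) \<longleftrightarrow>
    alive A ord joined j k \<and> (joined k \<longrightarrow> (\<exists>w\<in>cand ord joined j k. A (ord k) w))"
  unfolding alive_def less_Suc_eq by blast

lemma alive_new:
  "alive A ord joined (Suc k) (Suc k) \<longleftrightarrow> joined k \<and> (\<forall>p<k. A (ord p) (ord k))"
  by (auto simp: alive_def)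

lemma alive_dom: "alive A ord joined (Suc j) k \<Longrightarrow> joined j"
  by (simp add: alive_def)

lemma set_cand_list [simp]: "set (cand_list ord joined n j) = cand ord joined j n"
  by (auto simp: cand_list_def cand_def)

locale construction_sequence = finite_digraph +
  fixes ord :: "nat \<Rightarrow> nat" and joined :: "nat \<Rightarrow> bool"
  assumes bij: "bij_betw ord {..<n} {..<n}"
    and adjacent_ord: "j < k \<Longrightarrow> k < n \<Longrightarrow> adjacent (ord j) (ord k) \<longleftrightarrow> joined k"
begin

definition is_kernel :: "nat set \<Rightarrow> bool" where
  "is_kernel K \<longleftrightarrow> K \<subseteq> {..<n} \<and> (\<forall>u\<in>K. \<forall>v\<in>K. \<not> adjacent u v) \<and> (\<forall>u\<in>{..<n} - K. \<exists>v\<in>K. A u v)"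

lemma ord_eq_iff: "j < n \<Longrightarrow> k < n \<Longrightarrow> ord j = ord k \<longleftrightarrow> j = k"
  using bij by (auto simp: bij_betw_def inj_on_def)

lemma ord_less: "j < n \<Longrightarrow> ord j < n"
  using bij by (auto simp: bij_betw_def)

lemma ord_surj: "u < n \<Longrightarrow> \<exists>j<n. u = ord j"
  using bij by (auto simp: bij_betw_def image_iff set_eq_iff)

lemma adjacent_ord_max:
  "j < n \<Longrightarrow> k < n \<Longrightarrow> adjacent (ord j) (ord k) \<longleftrightarrow> j \<noteq> k \<and> joined (max j k)"
  using adjacent_ord[of j k] adjacent_ord[of k j] adjacent_sym[of "ord j" "ord k"]
  by (cases j k rule: linorder_cases) (auto simp: max_def)

lemma cand_subset: "j \<le> n \<Longrightarrow> cand ord joined j n \<subseteq> {..<n}"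
  using ord_less by (auto simp: cand_def)

lemma in_cand_iff:
  assumes "p < n" "j \<le> n" "k \<le> n"
  shows "ord p \<in> cand ord joined j k \<longleftrightarrow> (j \<noteq> 0 \<and> p = j - 1) \<or> (j \<le> p \<and> p < k \<and> \<not> joined p)"
  using assms ord_eq_iff by (auto simp: cand_def image_iff)

text \<open>A vertex outside the candidate either precedes its start, and then points to it, or is a
  later dominating vertex, absorbed by the part before it.\<close>

lemma cand_is_kernel:
  assumes j: "j \<le> n" and alive: "alive A ord joined j n"
  shows "is_kernel (cand ord joined j n)"
proof -
  have ind: "\<not> adjacent u v" if u: "u \<in> cand ord joined j n" and v: "v \<in> cand ord joined j n" for u v
  proof -
    obtain p q where pq: "p < n" "u = ord p" "q < n" "v = ord q"
      using u v cand_subset[OF j] ord_surj by (meson lessThan_iff subsetD)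
    then show ?thesis
      using u v j by (auto simp: in_cand_iff adjacent_ord_max max_def split: if_splits)
  qed
  have "\<exists>v\<in>cand ord joined j n. A u v" if u: "u < n" "u \<notin> cand ord joined j n" for u
  proof -
    obtain p where p: "p < n" "u = ord p" using u(1) ord_surj by auto
    have "p < j - 1 \<or> j \<le> p \<and> joined p"
      using u(2) p j by (auto simp: in_cand_iff)
    then show ?thesis
    proof
      assume "p < j - 1"
      then show ?thesis using alive p unfolding alive_def cand_def by auto
    next
      assume "j \<le> p \<and> joined p"
      then obtain w where "w \<in> cand ord joined j p" "A u w" using alive p by (auto simp: alive_def)
      moreover have "cand ord joined j p \<subseteq> cand ord joined j n" using p by (auto simp: cand_def)
      ultimately show ?thesis by blast
    qed
  qed
  then show ?thesis using ind cand_subset[OF j] by (auto simp: is_kernel_def)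
qed

text \<open>Independence allows at most one dominating vertex in \<open>K\<close>, with no member of
  \<open>K\<close> at an earlier position; absorption forces all later isolated vertices into
  \<open>K\<close>.\<close>

lemma kernel_is_cand:
  assumes "is_kernel K"
  shows "\<exists>j\<le>n. alive A ord joined j n \<and> K = cand ord joined j n"
proof -
  have sub: "K \<subseteq> {..<n}" and ind: "\<And>p q. p < n \<Longrightarrow> q < n \<Longrightarrow> ord p \<in> K \<Longrightarrow> ord q \<in> K \<Longrightarrow> p \<noteq> q \<Longrightarrow> \<not> joined (max p q)"
    using assms adjacent_ord_max unfolding is_kernel_def by blast+
  have absorb: "\<exists>q<n. ord q \<in> K \<and> A (ord p) (ord q) \<and> p \<noteq> q \<and> joined (max p q)" if "p < n" "ord p \<notin> K" for p
  proof -
    have "ord p \<in> {..<n} - K" using that ord_less by simp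
    then obtain v where v: "v \<in> K" "A (ord p) v" using assms unfolding is_kernel_def by meson
    moreover obtain q where "q < n" "v = ord q" using v sub ord_surj by auto
    ultimately show ?thesis using adjacent_ord_max[of p q] that by (auto simp: adjacent_def)
  qed
  \<comment> \<open>\<open>j\<close> is one more than the position of the dominating vertex in
    \<open>K\<close>, and \<open>0\<close> if there is none.\<close>
  obtain j where j: "j \<le> n" and start: "j \<noteq> 0 \<Longrightarrow> ord (j - 1) \<in> K \<and> joined (j - 1)"
    and only: "\<And>p. p < n \<Longrightarrow> ord p \<in> K \<Longrightarrow> joined p \<Longrightarrow> j \<noteq> 0 \<and> p = j - 1"
  proof (cases "\<exists>p<n. ord p \<in> K \<and> joined p")
    case True
    then obtain p where p: "p < n" "ord p \<in> K" "joined p" by auto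
    show ?thesis
    proof (rule that[of "Suc p"])
      show "Suc p \<noteq> 0 \<and> q = Suc p - 1" if "q < n" "ord q \<in> K" "joined q" for q
        using ind[of p q] p that by (cases "q = p") (auto simp: max_def split: if_splits)
    qed (use p in auto)
  next
    case False
    then show ?thesis using that[of 0] by auto
  qed
  have mem: "ord p \<in> K \<longleftrightarrow> ord p \<in> cand ord joined j n" if p: "p < n" for p
  proof
    assume pK: "ord p \<in> K"
    then have "j \<le> p" if "j \<noteq> 0" "p \<noteq> j - 1"
    proof -
      have "j - 1 < n" using p j by linarith
      then show ?thesis
        using ind[of "j - 1" p] pK start that p by (cases "j - 1 \<le> p") (auto simp: max_def)
    qed
    then show "ord p \<in> cand ord joined j n"
      using only[OF p pK] p j by (cases "j = 0") (auto simp: in_cand_iff)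
  next
    assume "ord p \<in> cand ord joined j n"
    then consider "j \<noteq> 0" "p = j - 1" | "j \<le> p" "\<not> joined p"
      using p j by (auto simp: in_cand_iff)
    then show "ord p \<in> K"
    proof cases
      case 1
      then show ?thesis using start by simp
    next
      case 2
      show ?thesis
      proof (rule ccontr)
        assume "ord p \<notin> K"
        \<comment> \<open>As \<open>p\<close> is isolated, it can only be absorbed by a dominating
          vertex at a later position, but a dominating vertex of \<open>K\<close> lies before
          \<open>j\<close>.\<close>
        then obtain q where q: "q < n" "ord q \<in> K" "p \<noteq> q" "joined (max p q)" using absorb p by blast
        then have "q > p" "joined q" using 2 by (auto simp: max_def split: if_splits)
        then show False using only[OF q(1,2)] 2 by auto
      qed
    qed
  qed
  have K: "K = cand ord joined j n"
  proof (rule set_eqI)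
    show "u \<in> K \<longleftrightarrow> u \<in> cand ord joined j n" for u
      using sub cand_subset[OF j] mem ord_surj[of u] by (cases "u < n") auto
  qed
  have "\<exists>w\<in>cand ord joined j q. A (ord q) w" if q: "j \<le> q" "q < n" "joined q" for q
  proof -
    have "ord q \<notin> K" using only[of q] q by auto
    then obtain p where p: "p < n" "ord p \<in> K" "A (ord q) (ord p)" "q \<noteq> p" "joined (max q p)"
      using absorb q by blast
    have "p < q" using p only[of p] q by (auto simp: max_def split: if_splits)
    then have "ord p \<in> cand ord joined j q"
      using p q j unfolding K by (auto simp: in_cand_iff)
    then show ?thesis using p by blast
  qed
  moreover have "A (ord p) (ord (j - 1))" if p: "p < j - 1" for p
  proof -
    have "ord p \<notin> K" using p j unfolding K by (auto simp: in_cand_iff)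
    moreover have "p < n" using p j by simp
    ultimately obtain q where q: "q < n" "ord q \<in> K" "A (ord p) (ord q)" "p \<noteq> q" "joined (max p q)"
      using absorb by blast
    have "q = j - 1"
      using q p j unfolding K by (auto simp: in_cand_iff max_def split: if_splits)
    then show ?thesis using q by simp
  qed
  ultimately have "alive A ord joined j n" using start by (auto simp: alive_def)
  then show ?thesis using j K by blast
qed

lemma kernels_eq: "{K. is_kernel K} = (\<lambda>j. cand ord joined j n) ` set (alive_list A ord joined n)"
proof (intro set_eqI iffI)
  show "K \<in> (\<lambda>j. cand ord joined j n) ` set (alive_list A ord joined n)" if "K \<in> {K. is_kernel K}" for K
    using kernel_is_cand[of K] that by auto
  show "K \<in> {K. is_kernel K}" if "K \<in> (\<lambda>j. cand ord joined j n) ` set (alive_list A ord joined n)" for K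
    using that cand_is_kernel by auto
qed

text \<open>All members of an alive candidate except its start are isolated, so the start of one
  candidate lies in no other. The auxiliary claim leaves out index \<open>0\<close> on one side and
  is therefore used in both directions.\<close>

lemma inj_cand: "inj_on (\<lambda>j. cand ord joined j n) (set (alive_list A ord joined n))"
proof -
  have *: "i = 0 \<or> i = j"
    if "i \<le> n" "j \<le> n" "alive A ord joined i n" "alive A ord joined j n" "cand ord joined i n = cand ord joined j n" for i j
  proof (cases "i = 0")
    case False
    then have "joined (i - 1)" "ord (i - 1) \<in> cand ord joined i n"
      using that by (auto simp: alive_def cand_def)
    then have "ord (i - 1) \<in> cand ord joined j n" using that by simp
    then show ?thesis using \<open>joined (i - 1)\<close> that False
      by (auto simp: in_cand_iff)
  qed simp
  show ?thesis
  proof (rule inj_onI)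
    fix i j assume "i \<in> set (alive_list A ord joined n)" "j \<in> set (alive_list A ord joined n)"
      and "cand ord joined i n = cand ord joined j n"
    then show "i = j" using *[of i j] *[of j i] by auto
  qed
qed

lemma distinct_alive_list: "distinct (alive_list A ord joined n)"
  by (simp add: alive_list_def)

lemma distinct_cand_list:
  assumes "j \<le> n"
  shows "distinct (cand_list ord joined n j)"
proof -
  have "distinct (map ord (filter (\<lambda>p. \<not> joined p) [j..<n]))"
    using ord_eq_iff by (auto simp: distinct_map inj_on_def)
  then show ?thesis using assms by (auto simp: cand_list_def ord_eq_iff)
qed

lemma card_kernels: "card {K. is_kernel K} = length (alive_list A ord joined n)"
  by (simp add: kernels_eq card_image inj_cand distinct_card distinct_alive_list)

section \<open>Bounds by cliques and edges\<close>

lemma dominating_clique: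
  assumes "u \<in> ord ` {k. k < n \<and> joined k}" "v \<in> ord ` {k. k < n \<and> joined k}" "u \<noteq> v"
  shows "adjacent u v"
  using assms by (auto simp: adjacent_ord_max max_def)

text \<open>Every alive candidate other than \<open>0\<close> starts at a dominating
  position.\<close>

lemma length_alive_list_le: "length (alive_list A ord joined n) \<le> Suc (card {k. k < n \<and> joined k})"
proof -
  have "set (alive_list A ord joined n) \<subseteq> insert 0 (Suc ` {k. k < n \<and> joined k})"
  proof
    fix j assume "j \<in> set (alive_list A ord joined n)"
    then have "j \<le> n" "alive A ord joined j n" by simp_all
    then show "j \<in> insert 0 (Suc ` {k. k < n \<and> joined k})"
      using alive_dom[of A ord joined _ n] by (cases j) auto
  qed
  then have "card (set (alive_list A ord joined n)) \<le> card (insert 0 (Suc ` {k. k < n \<and> joined k}))"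
    by (intro card_mono) auto
  also have "\<dots> = Suc (card {k. k < n \<and> joined k})"
    by (subst card_insert_disjoint) (auto simp: card_image)
  finally show ?thesis by (simp add: distinct_card distinct_alive_list)
qed

text \<open>The left side is the total length of the backward scans. The dominating vertex at
  position \<open>k\<close> has an edge to each of its \<open>k\<close> predecessors, and these
  edges are distinct for different pairs.\<close>

lemma sum_dominating_le_edges: "(\<Sum>k<n. if joined k then k else 0) \<le> card edges"
proof -
  have "(\<Sum>k<n. if joined k then k else 0) = (\<Sum>k\<in>{k. k < n \<and> joined k}. card {..<k})"
    by (rule sum.mono_neutral_cong_right) auto
  also have "\<dots> = card (SIGMA k:{k. k < n \<and> joined k}. {..<k})"
    by (subst card_SigmaI) auto
  also have "\<dots> \<le> card edges"
  proof (rule card_inj_on_le[where f = "\<lambda>(k, j). {ord k, ord j}"])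
    show "inj_on (\<lambda>(k, j). {ord k, ord j}) (SIGMA k:{k. k < n \<and> joined k}. {..<k})"
      by (auto simp: inj_on_def doubleton_eq_iff ord_eq_iff)
    show "(\<lambda>(k, j). {ord k, ord j}) ` (SIGMA k:{k. k < n \<and> joined k}. {..<k}) \<subseteq> edges"
      by (auto simp: edge_iff_adjacent adjacent_ord_max max_def)
  qed (rule finite_edges)
  finally show ?thesis .
qed

end

lemma (in finite_digraph) construction_sequenceI:
  assumes "eliminates ord joined 0"
  shows "construction_sequence n A ord joined"
proof unfold_locales
  have inj: "inj_on ord {..<n}" and sub: "ord ` {..<n} \<subseteq> {..<n}"
    using assms by (auto simp: eliminates_def atLeast0LessThan)
  then show "bij_betw ord {..<n} {..<n}"
    by (simp add: bij_betw_def endo_inj_surj)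
  show "adjacent (ord j) (ord k) \<longleftrightarrow> joined k" if "j < k" "k < n" for j k
  proof -
    have "ord j \<notin> ord ` {k..<n}"
      by (subst inj_on_image_mem_iff[OF inj]) (use that in auto)
    moreover have "ord j \<in> {..<n}" using sub that by (simp add: image_subset_iff)
    ultimately have "ord j \<in> remaining ord k" by (simp add: remaining_def)
    then show ?thesis using assms that unfolding eliminates_def by blast
  qed
qed

subsection \<open>Linked lists in arrays\<close>

text \<open>A pointer is \<open>0\<close> for the end of the list and \<open>Suc x\<close> for the cell \<open>x\<close>.\<close>

fun chain :: "(nat \<Rightarrow> nat) \<Rightarrow> nat \<Rightarrow> nat list \<Rightarrow> bool" where
  "chain nx h [] \<longleftrightarrow> h = 0"
| "chain nx h (x # xs) \<longleftrightarrow> h = Suc x \<and> chain nx (nx x) xs"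

lemma chain_update: "x \<notin> set xs \<Longrightarrow> chain (nx(x := y)) h xs \<longleftrightarrow> chain nx h xs"
  by (induction xs arbitrary: h) auto

text \<open>\<open>rev\<close>, because cells are prepended. Heads equal to \<open>0\<close> mean
  empty lists, so fresh memory needs no initialisation. The scheme serves twice: for arcs by target
  and for vertices by degree.\<close>

definition bucketed :: "(nat \<Rightarrow> nat) \<Rightarrow> nat \<Rightarrow> (nat \<Rightarrow> nat) \<Rightarrow> (nat \<Rightarrow> nat) \<Rightarrow> bool" where
  "bucketed f k h nx \<longleftrightarrow> (\<forall>d. chain nx (h d) (rev (filter (\<lambda>i. f i = d) [0..<k])))"

lemma bucketed_0 [simp]: "bucketed f 0 h nx \<longleftrightarrow> (\<forall>d. h d = 0)"
  by (simp add: bucketed_def)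

lemma bucketed_Suc:
  "bucketed f k h nx \<Longrightarrow> bucketed f (Suc k) (h(f k := Suc k)) (nx(k := h (f k)))"
  by (auto simp: bucketed_def chain_update)

subsection \<open>Adjacency lists\<close>

locale adjacency_lists = threshold_digraph n A for n A +
  fixes adj :: "nat list list"
  assumes length_adj: "length adj = n"
    and distinct_adj: "u < n \<Longrightarrow> distinct (adj ! u)"
    and set_adj: "u < n \<Longrightarrow> set (adj ! u) = {v. A u v}"
begin

definition off :: "nat \<Rightarrow> nat" where
  "off u = length (concat (take u adj))"

definition target :: "nat \<Rightarrow> nat" where
  "target e = concat adj ! e"

definition arc_count :: nat where
  "arc_count = length (concat adj)"

definition is_source :: "nat \<Rightarrow> nat \<Rightarrow> bool" where
  "is_source e u \<longleftrightarrow> u < n \<and> off u \<le> e \<and> e < off (Suc u)"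

text \<open>The arcs into \<open>v\<close> in the order in which the linked list of bucket
  \<open>v\<close> is traversed.\<close>

definition in_list :: "nat \<Rightarrow> nat list" where
  "in_list v = rev (filter (\<lambda>e. target e = v) [0..<arc_count])"

lemma off_0 [simp]: "off 0 = 0"
  by (simp add: off_def)

lemma off_Suc: "u < n \<Longrightarrow> off (Suc u) = off u + length (adj ! u)"
  by (simp add: off_def length_adj take_Suc_conv_app_nth)

lemma off_n: "off n = arc_count"
  by (simp add: off_def arc_count_def length_adj)

lemma off_mono: "u \<le> v \<Longrightarrow> off u \<le> off v"
proof -
  assume "u \<le> v"
  then have "take v adj = take u adj @ take (v - u) (drop u adj)"
    by (metis le_add_diff_inverse take_add)
  then show ?thesis by (simp add: off_def)
qed

lemma off_Suc_le: "u < n \<Longrightarrow> off (Suc u) \<le> arc_count"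
  using off_mono[of "Suc u" n] off_n by simp

lemma target_off:
  assumes "u < n" "i < length (adj ! u)"
  shows "target (off u + i) = adj ! u ! i"
proof -
  have "adj = take u adj @ adj ! u # drop (Suc u) adj"
    using assms length_adj by (simp add: id_take_nth_drop)
  then have "concat adj = concat (take u adj) @ adj ! u @ concat (drop (Suc u) adj)"
    by (metis concat.simps(2) concat_append)
  then show ?thesis using assms by (simp add: target_def off_def nth_append)
qed

lemma is_sourceE:
  assumes "is_source e u"
  obtains i where "u < n" "i < length (adj ! u)" "e = off u + i" "target e = adj ! u ! i"
proof -
  have "u < n" "e - off u < length (adj ! u)" "e = off u + (e - off u)"
    using assms by (auto simp: is_source_def off_Suc)
  then show ?thesis using that target_off by metis
qed

lemma arc_target: "is_source e u \<Longrightarrow> A u (target e)"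
  by (erule is_sourceE) (metis set_adj nth_mem mem_Collect_eq)

lemma arc_obtain:
  assumes "A u v"
  obtains e where "is_source e u" "target e = v"
proof -
  have u: "u < n" using assms bounded by blast
  then obtain i where i: "i < length (adj ! u)" "adj ! u ! i = v"
    using assms set_adj by (metis in_set_conv_nth mem_Collect_eq)
  then show ?thesis
    using that[of "off u + i"] target_off u by (auto simp: is_source_def off_Suc)
qed

lemma arc_index_unique:
  assumes "is_source e u" "is_source e' u" "target e = target e'"
  shows "e = e'"
proof -
  obtain i where i: "u < n" "i < length (adj ! u)" "e = off u + i" "target e = adj ! u ! i"
    using assms(1) by (rule is_sourceE)
  obtain j where j: "j < length (adj ! u)" "e' = off u + j" "target e' = adj ! u ! j"
    using assms(2) by (rule is_sourceE)
  have "i = j"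
    using i j assms(3) nth_eq_iff_index_eq[OF distinct_adj[OF i(1)]] by metis
  then show ?thesis using i(3) j(2) by simp
qed

lemma is_source_less: "is_source e u \<Longrightarrow> e < arc_count"
  using off_Suc_le[of u] by (auto simp: is_source_def)

lemma is_source_unique: "is_source e u \<Longrightarrow> is_source e u' \<Longrightarrow> u = u'"
  unfolding is_source_def
  by (metis Suc_leI leD le_less_trans linorder_neqE_nat off_mono order.strict_trans2)

text \<open>Within one adjacency list the targets are distinct, so a traversal of the arcs into
  \<open>v\<close> meets each in-neighbour exactly once.\<close>

lemma in_sources:
  assumes "\<forall>e<arc_count. is_source e (src e)"
  shows "distinct (map src (in_list v))" "set (map src (in_list v)) = {u. A u v}"
proof -
  show "distinct (map src (in_list v))"
    unfolding in_list_def distinct_map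
  proof (intro conjI inj_onI)
    fix e e' assume "e \<in> set (rev (filter (\<lambda>e. target e = v) [0..<arc_count]))"
      and "e' \<in> set (rev (filter (\<lambda>e. target e = v) [0..<arc_count]))" and eq: "src e = src e'"
    then have "is_source e (src e)" "is_source e' (src e)" "target e = target e'"
      using assms by auto
    then show "e = e'" by (rule arc_index_unique)
  qed simp
  have *: "\<exists>e. e < arc_count \<and> target e = v \<and> src e = u" if uv: "A u v" for u
  proof -
    obtain e where e: "is_source e u" "target e = v" using uv by (rule arc_obtain)
    then show ?thesis using assms is_source_less is_source_unique by metis
  qed
  show "set (map src (in_list v)) = {u. A u v}"
  proof (intro set_eqI iffI)
    fix u
    show "u \<in> {u. A u v}" if "u \<in> set (map src (in_list v))"
      using that assms arc_target by (auto simp: in_list_def)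
    show "u \<in> set (map src (in_list v))" if "u \<in> {u. A u v}"
      using that *[of u] by (auto simp: in_list_def)
  qed
qed

text \<open>An in-neighbour that is also an out-neighbour has been counted already; this is what
  \<open>mark_in\<close> checks against the marks left by \<open>mark_out\<close>.\<close>

lemma deg_eq:
  assumes "v < n" "\<forall>e<arc_count. is_source e (src e)"
  shows "deg v = length (adj ! v) + length (filter (\<lambda>e. \<not> A v (src e)) (in_list v))"
proof -
  have "{w. w < n \<and> adjacent v w} = set (adj ! v) \<union> set (filter (\<lambda>u. \<not> A v u) (map src (in_list v)))"
    using bounded in_sources(2)[OF assms(2), of v] assms(1)
    by (auto simp: set_adj adjacent_def simp del: set_map)
  moreover have "set (adj ! v) \<inter> set (filter (\<lambda>u. \<not> A v u) (map src (in_list v))) = {}"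
    using assms(1) by (auto simp: set_adj)
  moreover have "card (set (filter (\<lambda>u. \<not> A v u) (map src (in_list v)))) =
      length (filter (\<lambda>u. \<not> A v u) (map src (in_list v)))"
    using in_sources(1)[OF assms(2)] by (intro distinct_card distinct_filter)
  ultimately show ?thesis
    using assms(1) by (simp add: deg_def card_Un_disjoint distinct_card distinct_adj filter_map comp_def)
qed

lemma sum_out: "(\<Sum>u<n. length (adj ! u)) = arc_count"
proof -
  have "(\<Sum>u<m. length (adj ! u)) = off m" if "m \<le> n" for m
    using that by (induction m) (auto simp: off_Suc)
  then show ?thesis using off_n by simp
qed

lemma target_bounded: "e < arc_count \<Longrightarrow> target e < n"
proof -
  assume "e < arc_count"
  then have "target e \<in> set (concat adj)" unfolding target_def arc_count_def by (rule nth_mem)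
  then obtain u where "u < n" "target e \<in> set (adj ! u)"
    using length_adj by (auto simp: in_set_conv_nth[of _ adj])
  then show ?thesis using set_adj bounded by blast
qed

lemma sum_in: "(\<Sum>v<n. length (in_list v)) = arc_count"
proof -
  have "(\<Sum>v<n. length (in_list v)) = (\<Sum>v<n. card {e \<in> {..<arc_count}. target e = v})"
    by (auto simp: in_list_def length_filter_conv_card intro!: sum.cong arg_cong[where f = card])
  also have "\<dots> = arc_count"
    using sum.group[of "{..<arc_count}" "{..<n}" target "\<lambda>_. 1 :: nat"] target_bounded by auto
  finally show ?thesis .
qed

lemma arc_count_le: "arc_count \<le> 2 * card edges"
proof -
  have "arc_count = (\<Sum>u<n. card {v. A u v})"
    using sum_out by (simp add: distinct_card[OF distinct_adj, symmetric] set_adj)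
  also have "\<dots> = card (SIGMA u:{..<n}. {v. A u v})"
    by (subst card_SigmaI) (auto intro: finite_subset[of _ "{..<n}"] dest: bounded)
  also have "(SIGMA u:{..<n}. {v. A u v}) = {(u, v). A u v}"
    using bounded by auto
  finally show ?thesis using card_arcs_le by simp
qed

end

subsection \<open>Degree lists\<close>

text \<open>
  Arrays: 0, 1 input; 2 heads of the lists of incoming arcs, 3 their links, 4 sources of arcs;
  5, 6 marks of out- and in-neighbours (mark \<open>v + 1\<close> stands for \<open>v\<close>, so that marks never have to be
  erased); 7 heads of the lists of vertices of equal degree, 8 their links; 9 vertex at a position,
  10 flag of dominating positions; 11 flags of candidates; 12 surviving candidates.

  Registers: 0 number of vertices; 2 vertex; 3 arc or link; 4 degree; 5 bucket; 6 remaining vertices,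
  7 removed dominating vertices, 8 the sum of both; 9 position, 10 candidate; 11 whether
  an isolated out-neighbour has been met, 12 whether all scanned vertices point to the current one;
  13 output length, 14 number of kernels, 15 kernels written.
\<close>

declare One_nat_def [simp del] eval_expr.simps(4) [simp del]

lemma eval_Succ [simp]: "eval_expr (Succ e) s = Suc (eval_expr e s)"
  by (simp add: eval_expr.simps(4))

abbreviation seq :: "prog \<Rightarrow> prog \<Rightarrow> prog" (infixr ";;" 60) where
  "p ;; q \<equiv> Seq p q"

definition add_out_arcs :: prog where
  "add_out_arcs =
    While (Less (Reg 3) (Read 0 (Succ (Reg 2))))
      (Store 3 (Reg 3) (Read 2 (Read 1 (Reg 3))) ;;
       Store 2 (Read 1 (Reg 3)) (Succ (Reg 3)) ;;
       Store 4 (Reg 3) (Reg 2) ;;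
       Assign 3 (Succ (Reg 3)))"

text \<open>Register 3 is not reset between vertices: the end of one block of arcs is the start of
  the next.\<close>

definition build_in_lists :: prog where
  "build_in_lists =
    Assign 2 (Const 0) ;; Assign 3 (Const 0) ;;
    While (Less (Reg 2) (Reg 0)) (add_out_arcs ;; Assign 2 (Succ (Reg 2)))"

definition mark_out :: prog where
  "mark_out =
    While (Less (Reg 3) (Read 0 (Succ (Reg 2))))
      (Store 5 (Read 1 (Reg 3)) (Succ (Reg 2)) ;;
       Assign 4 (Succ (Reg 4)) ;;
       Assign 3 (Succ (Reg 3)))"

definition mark_in :: prog where
  "mark_in =
    While (Not (Equal (Reg 3) (Const 0)))
      (Store 6 (Read 4 (Pred (Reg 3))) (Succ (Reg 2)) ;;
       Cond (Equal (Read 5 (Read 4 (Pred (Reg 3)))) (Succ (Reg 2))) Skip (Assign 4 (Succ (Reg 4))) ;;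
       Assign 3 (Read 3 (Pred (Reg 3))))"

definition mark_neighbours :: prog where
  "mark_neighbours =
    Assign 4 (Const 0) ;; Assign 3 (Read 0 (Reg 2)) ;; mark_out ;;
    Assign 3 (Read 2 (Reg 2)) ;; mark_in"

definition build_degree_lists :: prog where
  "build_degree_lists =
    Assign 2 (Const 0) ;;
    While (Less (Reg 2) (Reg 0))
      (mark_neighbours ;;
       Store 8 (Reg 2) (Read 7 (Reg 4)) ;;
       Store 7 (Reg 4) (Succ (Reg 2)) ;;
       Assign 2 (Succ (Reg 2)))"

lemma written_add_out_arcs [simp]:
  "written_regs add_out_arcs = {3}" "written_arrs add_out_arcs = {2, 3, 4}"
  by (auto simp: add_out_arcs_def)

lemma written_mark_out [simp]:
  "written_regs mark_out = {3, 4}" "written_arrs mark_out = {5}"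
  by (auto simp: mark_out_def)

lemma written_mark_in [simp]:
  "written_regs mark_in = {3, 4}" "written_arrs mark_in = {6}"
  by (auto simp: mark_in_def)

lemma written_mark_neighbours [simp]:
  "written_regs mark_neighbours = {3, 4}" "written_arrs mark_neighbours = {5, 6}"
  by (auto simp: mark_neighbours_def)

section \<open>Correctness and cost of the degree computation\<close>

context adjacency_lists
begin

definition graph_stored :: "store \<Rightarrow> bool" where
  "graph_stored s \<longleftrightarrow> reg s 0 = n \<and> (\<forall>u\<le>n. arr s 0 u = off u) \<and> (\<forall>e<arc_count. arr s 1 e = target e)"

definition in_lists_stored :: "store \<Rightarrow> bool" where
  "in_lists_stored s \<longleftrightarrow> bucketed target arc_count (arr s 2) (arr s 3) \<and> (\<forall>e<arc_count. is_source e (arr s 4 e))"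

text \<open>A dominating vertex is marked for a second time when candidates are updated, so its old
  marks may still be present. They are harmless because they are true; hence the invariant demands
  truth of all marks instead of absence of old ones.\<close>

definition marks_sound :: "store \<Rightarrow> bool" where
  "marks_sound s \<longleftrightarrow> (\<forall>w v. arr s 5 w = Suc v \<longrightarrow> A v w) \<and> (\<forall>w v. arr s 6 w = Suc v \<longrightarrow> A w v)"

definition degree_lists_stored :: "store \<Rightarrow> bool" where
  "degree_lists_stored s \<longleftrightarrow> bucketed deg n (arr s 7) (arr s 8)"

lemma graph_stored_input: "graph_stored (input_store adj)"
  by (simp add: graph_stored_def input_store_def length_adj off_def arc_count_def target_def)

definition arcs_added :: "nat \<Rightarrow> store \<Rightarrow> bool" where
  "arcs_added e s \<longleftrightarrow> reg s 3 = e \<and> bucketed target e (arr s 2) (arr s 3) \<and> (\<forall>i<e. is_source i (arr s 4 i))"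

lemma runs_add_out_arcs:
  assumes "graph_stored s" "u < n" "reg s 2 = u" "arcs_added (off u) s"
    and post: "\<And>t s'. unchanged add_out_arcs s s' \<Longrightarrow> arcs_added (off (Suc u)) s' \<Longrightarrow>
      t \<le> 5 * length (adj ! u) + 1 \<Longrightarrow> Q t s'"
  shows "runs add_out_arcs s Q"
proof (rule runs_unchanged, unfold add_out_arcs_def,
    rule runs_While_up[where I = arcs_added and a = "off u" and b = "off (Suc u)" and f = "\<lambda>_. 4"],
    goal_cases)
  case (3 k s')
  have src: "is_source k u" using 3 assms(2) by (simp add: is_source_def)
  show ?case
    using 3 assms is_source_less[OF src] src bucketed_Suc[of target k "arr s' 2" "arr s' 3"]
    by (auto simp: arcs_added_def unchanged_def graph_stored_def less_Suc_eq)
next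
  case (5 t s')
  then show ?case
    using assms(2) post unfolding add_out_arcs_def[symmetric] by (simp add: off_Suc)
qed (use assms in \<open>auto simp: off_Suc arcs_added_def unchanged_def graph_stored_def\<close>)

lemma runs_build_in_lists:
  assumes graph: "graph_stored s" and "\<forall>v. arr s 2 v = 0"
    and post: "\<And>t s'. unchanged build_in_lists s s' \<Longrightarrow> in_lists_stored s' \<Longrightarrow>
      t \<le> 5 * arc_count + 3 * n + 3 \<Longrightarrow> Q t s'"
  shows "runs build_in_lists s Q"
proof (rule runs_unchanged, unfold build_in_lists_def runs_Seq runs_Assign,
    rule runs_While_up[where I = "\<lambda>u s'. reg s' 2 = u \<and> arcs_added (off u) s'" and a = 0 and b = n
      and f = "\<lambda>u. 5 * length (adj ! u) + 2"], goal_cases)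
  case (3 u s')
  have g: "graph_stored s'"
    using 3 graph by (simp add: unchanged_def graph_stored_def)
  have "eval_test (Less (Reg 2) (Reg 0)) s'" using g 3 by (simp add: graph_stored_def)
  moreover have "runs (add_out_arcs ;; Assign 2 (Succ (Reg 2))) s'
      (\<lambda>t s''. (reg s'' 2 = Suc u \<and> arcs_added (off (Suc u)) s'') \<and> t \<le> 5 * length (adj ! u) + 2)"
    unfolding runs_Seq
    by (rule runs_add_out_arcs[OF g, where u = u]) (use 3 in \<open>auto simp: arcs_added_def unchanged_def\<close>)
  ultimately show ?case ..
next
  case (5 t s')
  then have "in_lists_stored s'" by (simp add: in_lists_stored_def arcs_added_def off_n)
  then show ?case
    using 5 post sum_out unfolding build_in_lists_def[symmetric]
    by (simp add: atLeast0LessThan sum.distrib sum_Suc sum_distrib_left[symmetric])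
qed (use assms in \<open>simp_all add: arcs_added_def unchanged_def graph_stored_def\<close>)

lemma runs_mark_out:
  assumes graph: "graph_stored s" and v: "v < n" "reg s 2 = v" "reg s 3 = off v" "reg s 4 = 0"
    and sound: "\<forall>w x. arr s 5 w = Suc x \<longrightarrow> A x w"
    and post: "\<And>t s'. unchanged mark_out s s' \<Longrightarrow> \<forall>w x. arr s' 5 w = Suc x \<longrightarrow> A x w \<Longrightarrow>
      \<forall>w. arr s' 5 w = Suc v \<longleftrightarrow> A v w \<Longrightarrow> reg s' 4 = length (adj ! v) \<Longrightarrow>
      t \<le> 4 * length (adj ! v) + 1 \<Longrightarrow> Q t s'"
  shows "runs mark_out s Q"
proof (rule runs_unchanged, unfold mark_out_def,
    rule runs_While_up[where a = "off v" and b = "off (Suc v)" and f = "\<lambda>_. 3"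
      and I = "\<lambda>k s'. reg s' 3 = k \<and> reg s' 4 = k - off v \<and> (\<forall>w x. arr s' 5 w = Suc x \<longrightarrow> A x w)
        \<and> (\<forall>e. off v \<le> e \<and> e < k \<longrightarrow> arr s' 5 (target e) = Suc v)"],
    goal_cases)
  case (3 k s')
  have src: "is_source k v" using 3 v(1) by (simp add: is_source_def)
  have "arr s 1 k = target k" using graph is_source_less[OF src] by (simp add: graph_stored_def)
  moreover have "A v (target k)" using src by (rule arc_target)
  ultimately show ?case
    using 3 v graph by (auto simp: unchanged_def less_Suc_eq Suc_diff_le graph_stored_def)
next
  case (5 t s')
  have "arr s' 5 w = Suc v" if "A v w" for w
  proof -
    obtain e where "is_source e v" "target e = w" using \<open>A v w\<close> by (rule arc_obtain)
    then show ?thesis using 5 by (auto simp: is_source_def)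
  qed
  then have "\<forall>w. arr s' 5 w = Suc v \<longleftrightarrow> A v w" using 5 by blast
  then show ?case
    using 5 post v(1) unfolding mark_out_def[symmetric] by (simp add: off_Suc)
qed (use assms in \<open>auto simp: off_Suc unchanged_def graph_stored_def\<close>)

lemma runs_mark_in:
  assumes lists: "in_lists_stored s" and v: "v < n" "reg s 2 = v" "reg s 3 = arr s 2 v"
    and out: "\<forall>w. arr s 5 w = Suc v \<longleftrightarrow> A v w" "reg s 4 = length (adj ! v)"
    and sound: "\<forall>w x. arr s 6 w = Suc x \<longrightarrow> A w x"
    and post: "\<And>t s'. unchanged mark_in s s' \<Longrightarrow> \<forall>w x. arr s' 6 w = Suc x \<longrightarrow> A w x \<Longrightarrow>
      \<forall>w. arr s' 6 w = Suc v \<longleftrightarrow> A w v \<Longrightarrow> reg s' 4 = deg v \<Longrightarrow>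
      t \<le> 5 * length (in_list v) + 1 \<Longrightarrow> Q t s'"
  shows "runs mark_in s Q"
proof -
  define L where "L = in_list v"
  define src where "src = arr s 4"
  have src: "\<forall>e<arc_count. is_source e (src e)"
    using lists by (simp add: in_lists_stored_def src_def)
  have chain: "chain (arr s 3) (arr s 2 v) L"
    using lists by (simp add: in_lists_stored_def bucketed_def L_def in_list_def)
  show ?thesis
  proof (rule runs_unchanged, unfold mark_in_def,
      rule runs_While_up[where a = 0 and b = "length L" and f = "\<lambda>_. 4"
        and I = "\<lambda>k s'. chain (arr s 3) (reg s' 3) (drop k L)
          \<and> reg s' 4 = length (adj ! v) + length (filter (\<lambda>e. \<not> A v (src e)) (take k L))
          \<and> (\<forall>w x. arr s' 6 w = Suc x \<longrightarrow> A w x) \<and> (\<forall>e\<in>set (take k L). arr s' 6 (src e) = Suc v)"],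
      goal_cases)
    case (3 k s')
    have "L ! k \<in> set L" using 3 by simp
    then have "A (src (L ! k)) v"
      using src arc_target[of "L ! k" "src (L ! k)"] by (simp add: L_def in_list_def)
    moreover have "drop k L = L ! k # drop (Suc k) L" using 3 by (simp add: Cons_nth_drop_Suc)
    ultimately show ?case
      using 3 v out by (auto simp: unchanged_def take_Suc_conv_app_nth src_def)
  next
    case (5 t s')
    have "arr s' 6 w = Suc v" if "A w v" for w
    proof -
      have "w \<in> set (map src L)" using in_sources(2)[OF src, of v] that by (simp add: L_def)
      then show ?thesis using 5 by auto
    qed
    then have "\<forall>w. arr s' 6 w = Suc v \<longleftrightarrow> A w v" using 5 by blast
    moreover have "reg s' 4 = deg v"
      using 5 deg_eq[OF v(1) src] by (simp add: L_def)
    ultimately show ?case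
      using 5 post unfolding mark_in_def[symmetric] by (simp add: L_def)
  qed (use v out chain sound in \<open>simp_all add: unchanged_def\<close>)
qed

lemma runs_mark_neighbours:
  assumes graph: "graph_stored s" and lists: "in_lists_stored s" and sound: "marks_sound s"
    and v: "v < n" "reg s 2 = v"
    and post: "\<And>t s'. unchanged mark_neighbours s s' \<Longrightarrow> marks_sound s' \<Longrightarrow>
      \<forall>w. arr s' 5 w = Suc v \<longleftrightarrow> A v w \<Longrightarrow> \<forall>w. arr s' 6 w = Suc v \<longleftrightarrow> A w v \<Longrightarrow>
      reg s' 4 = deg v \<Longrightarrow> t \<le> 4 * length (adj ! v) + 5 * length (in_list v) + 5 \<Longrightarrow> Q t s'"
  shows "runs mark_neighbours s Q"
proof (rule runs_unchanged, unfold mark_neighbours_def runs_Seq runs_Assign,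
    rule runs_mark_out[where v = v], goal_cases)
  case (7 t s')
  show ?case
  proof (rule runs_mark_in[where v = v], goal_cases)
    case (8 t' s'')
    then have "marks_sound s''" using 7 by (simp add: marks_sound_def unchanged_def)
    then show ?case
      using 7 8 post unfolding mark_neighbours_def[symmetric] by (simp add: unchanged_def)
  qed (use 7 assms in \<open>simp_all add: unchanged_def in_lists_stored_def marks_sound_def\<close>)
qed (use assms in \<open>simp_all add: graph_stored_def marks_sound_def\<close>)

lemma runs_build_degree_lists:
  assumes graph: "graph_stored s" and lists: "in_lists_stored s" and "marks_sound s" "\<forall>d. arr s 7 d = 0"
    and post: "\<And>t s'. unchanged build_degree_lists s s' \<Longrightarrow> marks_sound s' \<Longrightarrow> degree_lists_stored s' \<Longrightarrow>
      t \<le> 9 * arc_count + 9 * n + 2 \<Longrightarrow> Q t s'"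
  shows "runs build_degree_lists s Q"
proof (rule runs_unchanged, unfold build_degree_lists_def runs_Seq[of "Assign 2 (Const 0)"] runs_Assign,
    rule runs_While_up[where a = 0 and b = n and f = "\<lambda>u. 4 * length (adj ! u) + 5 * length (in_list u) + 8"
      and I = "\<lambda>u s'. reg s' 2 = u \<and> marks_sound s' \<and> bucketed deg u (arr s' 7) (arr s' 8)"],
    goal_cases)
  case (3 u s')
  have g: "graph_stored s'" and l: "in_lists_stored s'"
    using 3 graph lists by (simp_all add: unchanged_def graph_stored_def in_lists_stored_def)
  have "eval_test (Less (Reg 2) (Reg 0)) s'" using g 3 by (simp add: graph_stored_def)
  moreover have "runs (mark_neighbours ;; Store 8 (Reg 2) (Read 7 (Reg 4)) ;;
       Store 7 (Reg 4) (Succ (Reg 2)) ;; Assign 2 (Succ (Reg 2))) s'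
      (\<lambda>t s''. (reg s'' 2 = Suc u \<and> marks_sound s'' \<and> bucketed deg (Suc u) (arr s'' 7) (arr s'' 8))
        \<and> t \<le> 4 * length (adj ! u) + 5 * length (in_list u) + 8)"
    unfolding runs_Seq
  proof (rule runs_mark_neighbours[OF g l, where v = u], goal_cases)
    case (4 t s'')
    then show ?case
      using 3 bucketed_Suc[of deg u "arr s' 7" "arr s' 8"] by (simp add: unchanged_def marks_sound_def)
  qed (use 3 in simp_all)
  ultimately show ?case ..
next
  case (5 t s')
  then have "degree_lists_stored s'" by (simp add: degree_lists_stored_def)
  then show ?case
    using 5 post sum_out sum_in unfolding build_degree_lists_def[symmetric]
    by (simp add: atLeast0LessThan sum.distrib sum_Suc sum_distrib_left[symmetric])
qed (use assms in \<open>simp_all add: marks_sound_def unchanged_def graph_stored_def\<close>)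

end

subsection \<open>Computing a construction sequence\<close>

context finite_digraph
begin

text \<open>In contrast to \<open>bucketed\<close>, the order within a bucket is forgotten, so that
  removing a head preserves the form with a smaller \<open>S\<close>. The links \<open>nx\<close>
  never change.\<close>

definition degree_buckets :: "nat set \<Rightarrow> (nat \<Rightarrow> nat) \<Rightarrow> (nat \<Rightarrow> nat) \<Rightarrow> bool" where
  "degree_buckets S h nx \<longleftrightarrow>
    (\<forall>q. \<exists>L. chain nx (h q) L \<and> distinct L \<and> set L = {u \<in> S. deg u = q})"

lemma degree_buckets_bucketed: "bucketed deg m h nx \<Longrightarrow> degree_buckets {..<m} h nx"
  unfolding degree_buckets_def bucketed_def
proof (rule allI, rule exI, intro conjI)
  fix q assume "\<forall>d. chain nx (h d) (rev (filter (\<lambda>i. deg i = d) [0..<m]))"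
  then show "chain nx (h q) (rev (filter (\<lambda>i. deg i = q) [0..<m]))" ..
qed auto

lemma degree_buckets_empty_iff:
  assumes "degree_buckets S h nx"
  shows "h q = 0 \<longleftrightarrow> (\<forall>u\<in>S. deg u \<noteq> q)"
proof -
  obtain L where "chain nx (h q) L" "set L = {u \<in> S. deg u = q}"
    using assms unfolding degree_buckets_def by meson
  then show ?thesis by (cases L) auto
qed

lemma degree_buckets_pop:
  assumes "degree_buckets S h nx" "h q \<noteq> 0"
  obtains v where "h q = Suc v" "v \<in> S" "deg v = q" "degree_buckets (S - {v}) (h(q := nx v)) nx"
proof -
  obtain L where L: "chain nx (h q) L" "distinct L" "set L = {u \<in> S. deg u = q}"
    using assms(1) unfolding degree_buckets_def by meson
  then obtain v L' where v: "L = v # L'" using assms(2) by (cases L) auto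
  have vS: "v \<in> S" "deg v = q" using L(3) unfolding v by auto
  have "degree_buckets (S - {v}) (h(q := nx v)) nx"
    unfolding degree_buckets_def
  proof
    fix p
    show "\<exists>L. chain nx ((h(q := nx v)) p) L \<and> distinct L \<and> set L = {u \<in> S - {v}. deg u = p}"
    proof (cases "p = q")
      case True
      have "set L' = {u \<in> S - {v}. deg u = p}"
        using L(2,3) True unfolding v by (auto simp: set_eq_iff)
      then show ?thesis using L(1,2) True unfolding v by auto
    next
      case False
      then have "{u \<in> S - {v}. deg u = p} = {u \<in> S. deg u = p}" using vS by auto
      then show ?thesis using assms(1) False by (simp add: degree_buckets_def)
    qed
  qed
  then show ?thesis using that vS L(1) v by simp
qed

end

text \<open>An empty bucket \<open>d\<close> means that no remaining vertex is isolated, so a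
  dominating one exists. For \<open>r = 0\<close> both buckets coincide, and the last vertex counts
  as isolated. The conclusion covers every \<open>joined'\<close> with the right value at
  \<open>r\<close>, as the flags are read from an array.\<close>

lemma (in threshold_digraph) elimination_step:
  assumes elim: "eliminates ord joined (Suc r)"
    and buckets: "degree_buckets (remaining ord (Suc r)) h nx"
    and d: "d = dominating_after joined (Suc r)"
    and x: "x = (if h d = 0 then r + d else d)"
  obtains v where "h x = Suc v"
    "\<forall>joined'. (joined' r \<longleftrightarrow> h d = 0) \<longrightarrow> (\<forall>k>r. joined' k = joined k) \<longrightarrow>
      eliminates (ord(r := v)) joined' r \<and>
      degree_buckets (remaining (ord(r := v)) r) (h(x := nx v)) nx \<and>
      dominating_after joined' r = (if h d = 0 then Suc d else d)"
proof -
  have r: "r < n" using elim by (simp add: eliminates_def)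
  have "h x \<noteq> 0"
  proof (cases "h d = 0")
    case True
    then have "\<exists>u\<in>remaining ord (Suc r). deg u = r + d"
      using ex_dominating_deg[OF elim] degree_buckets_empty_iff[OF buckets, of d] d by blast
    then show ?thesis using x True degree_buckets_empty_iff[OF buckets, of x] by auto
  qed (simp add: x)
  then obtain v where v: "h x = Suc v" "v \<in> remaining ord (Suc r)" "deg v = x"
    and rest: "degree_buckets (remaining ord (Suc r) - {v}) (h(x := nx v)) nx"
    using degree_buckets_pop[OF buckets] by metis
  have adj: "adjacent u v \<longleftrightarrow> h d = 0" if "u \<in> remaining ord (Suc r)" "u \<noteq> v" for u
    using isolated_if_deg[OF elim v(2) _ that(1)] dominating_if_deg[OF elim v(2) _ that] v(3) x d
    by (auto split: if_splits)
  have "remaining (ord(r := v)) r = remaining ord (Suc r) - {v}"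
    using remaining_Suc[OF r, of "ord(r := v)" ord] by simp
  moreover have "eliminates (ord(r := v)) joined' r"
    if "joined' r \<longleftrightarrow> h d = 0" "\<And>k. r < k \<Longrightarrow> joined' k = joined k" for joined'
    by (rule eliminates_step[OF elim]) (use v adj that in auto)
  ultimately show ?thesis
    using that[OF v(1)] rest dominating_after_Suc[OF r, of _ joined] d by simp
qed

subsection \<open>Counting and enumerating kernels\<close>

lemma holds_list_append:
  assumes "holds_list s r a xs" "reg s' r = Suc (reg s r)" "arr s' a = (arr s a)(reg s r := x)"
  shows "holds_list s' r a (xs @ [x])"
  using assms by (auto simp: holds_list_def nth_append less_Suc_eq)

lemma holds_list_cong:
  "holds_list s r a xs \<Longrightarrow> reg s' r = reg s r \<Longrightarrow> arr s' a = arr s a \<Longrightarrow> holds_list s' r a xs"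
  by (simp add: holds_list_def)

text \<open>The machine cannot add in one step, so the sum of remaining and removed dominating
  vertices is maintained: removing a dominating vertex keeps it, removing an isolated one lowers it
  by one.\<close>

definition build_sequence :: prog where
  "build_sequence =
    Assign 6 (Reg 0) ;; Assign 7 (Const 0) ;; Assign 8 (Reg 0) ;;
    While (Less (Const 0) (Reg 6))
      (Assign 6 (Pred (Reg 6)) ;;
       Cond (Equal (Read 7 (Reg 7)) (Const 0))
         (Assign 5 (Pred (Reg 8)) ;; Store 10 (Reg 6) (Const 1) ;; Assign 7 (Succ (Reg 7)))
         (Assign 5 (Reg 7) ;; Store 10 (Reg 6) (Const 0) ;; Assign 8 (Pred (Reg 8))) ;;
       Store 9 (Reg 6) (Pred (Read 7 (Reg 5))) ;;
       Store 7 (Reg 5) (Read 8 (Pred (Read 7 (Reg 5)))))"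

text \<open>With \<open>j\<close> in register 10, the inspected vertex is the start of candidate
  \<open>j\<close>. If it is an out-neighbour, that candidate survives, and if it is isolated as
  well, so do all candidates with smaller index. Otherwise candidate \<open>j\<close> depends on the
  isolated out-neighbours met so far.\<close>

definition scan_earlier :: prog where
  "scan_earlier =
    While (Less (Const 0) (Reg 10))
      (Cond (Equal (Read 5 (Read 9 (Pred (Reg 10)))) (Succ (Reg 2)))
         (Cond (Equal (Read 10 (Pred (Reg 10))) (Const 0)) (Assign 11 (Const 1)) Skip)
         (Cond (Equal (Reg 11) (Const 0)) (Store 11 (Reg 10) (Const 0)) Skip) ;;
       Cond (Equal (Read 6 (Read 9 (Pred (Reg 10)))) (Succ (Reg 2))) Skip (Assign 12 (Const 0)) ;;
       Assign 10 (Pred (Reg 10)))"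

text \<open>Candidate \<open>0\<close> has no start that the scan could reach; the final value of
  the bit decides it afterwards.\<close>

definition process_dominating :: prog where
  "process_dominating =
    Assign 2 (Read 9 (Reg 9)) ;; mark_neighbours ;;
    Assign 11 (Const 0) ;; Assign 12 (Const 1) ;; Assign 10 (Reg 9) ;; scan_earlier ;;
    Cond (Equal (Reg 11) (Const 0)) (Store 11 (Const 0) (Const 0)) Skip ;;
    Store 11 (Succ (Reg 9)) (Reg 12)"

definition find_alive :: prog where
  "find_alive =
    Assign 9 (Const 0) ;; Store 11 (Const 0) (Const 1) ;;
    While (Less (Reg 9) (Reg 0))
      (Cond (Equal (Read 10 (Reg 9)) (Const 0)) (Store 11 (Succ (Reg 9)) (Const 0)) process_dominating ;;
       Assign 9 (Succ (Reg 9)))"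

definition list_alive :: prog where
  "list_alive =
    Assign 10 (Const 0) ;; Assign 14 (Const 0) ;;
    While (Not (Less (Reg 0) (Reg 10)))
      (Cond (Equal (Read 11 (Reg 10)) (Const 0)) Skip
         (Store 12 (Reg 14) (Reg 10) ;; Assign 14 (Succ (Reg 14))) ;;
       Assign 10 (Succ (Reg 10)))"

definition solve :: prog where
  "solve = build_in_lists ;; build_degree_lists ;; build_sequence ;; find_alive ;; list_alive"

definition write_cand :: "nat \<Rightarrow> prog" where
  "write_cand a =
    Cond (Equal (Reg 10) (Const 0)) Skip
      (Store a (Reg 13) (Read 9 (Pred (Reg 10))) ;; Assign 13 (Succ (Reg 13))) ;;
    While (Less (Reg 10) (Reg 0))
      (Cond (Equal (Read 10 (Reg 10)) (Const 0))
         (Store a (Reg 13) (Read 9 (Reg 10)) ;; Assign 13 (Succ (Reg 13))) Skip ;;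
       Assign 10 (Succ (Reg 10)))"

text \<open>Array 0 is reused for the output, its offsets being needed no more. Register 0 is
  overwritten last, because \<open>write_cand\<close> reads the number of vertices from it.\<close>

definition count_kernels :: prog where
  "count_kernels =
    solve ;; Assign 10 (Read 12 (Const 0)) ;; Assign 13 (Const 0) ;; write_cand 0 ;;
    Assign 0 (Reg 14) ;; Assign 1 (Reg 13)"

text \<open>The store after the loop supplies the end of the last list: there is one offset more
  than there are lists.\<close>

definition enumerate_kernels :: prog where
  "enumerate_kernels =
    solve ;; Assign 13 (Const 0) ;; Assign 15 (Const 0) ;;
    While (Less (Reg 15) (Reg 14))
      (Store 0 (Reg 15) (Reg 13) ;; Assign 10 (Read 12 (Reg 15)) ;; write_cand 1 ;;
       Assign 15 (Succ (Reg 15))) ;;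
    Store 0 (Reg 15) (Reg 13) ;; Assign 0 (Reg 14)"

section \<open>Correctness and cost of the kernel programs\<close>

lemma written_scan_earlier [simp]:
  "written_regs scan_earlier = {10, 11, 12}" "written_arrs scan_earlier = {11}"
  by (auto simp: scan_earlier_def)

lemma written_process_dominating [simp]:
  "written_regs process_dominating = {2, 3, 4, 10, 11, 12}" "written_arrs process_dominating = {5, 6, 11}"
  by (auto simp: process_dominating_def)

lemma written_build_in_lists [simp]:
  "written_regs build_in_lists = {2, 3}" "written_arrs build_in_lists = {2, 3, 4}"
  by (auto simp: build_in_lists_def)

lemma written_build_degree_lists [simp]:
  "written_regs build_degree_lists = {2, 3, 4}" "written_arrs build_degree_lists = {5, 6, 7, 8}"
  by (auto simp: build_degree_lists_def)

lemma written_build_sequence [simp]: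
  "written_regs build_sequence = {5, 6, 7, 8}" "written_arrs build_sequence = {7, 9, 10}"
  by (auto simp: build_sequence_def)

lemma written_find_alive [simp]:
  "written_regs find_alive = {2, 3, 4, 9, 10, 11, 12}" "written_arrs find_alive = {5, 6, 11}"
  by (auto simp: find_alive_def)

lemma written_list_alive [simp]:
  "written_regs list_alive = {10, 14}" "written_arrs list_alive = {12}"
  by (auto simp: list_alive_def)

lemma written_write_cand [simp]:
  "written_regs (write_cand a) = {10, 13}" "written_arrs (write_cand a) = {a}"
  by (auto simp: write_cand_def)

abbreviation stored_joined :: "store \<Rightarrow> nat \<Rightarrow> bool" where
  "stored_joined s \<equiv> \<lambda>k. arr s 10 k \<noteq> 0"

lemma runs_write_cand:
  assumes a: "a \<noteq> 9" "a \<noteq> 10" and list: "holds_list s 13 a ys" and s: "reg s 0 = n" "reg s 10 = j"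
    and post: "\<And>t s'. unchanged (write_cand a) s s' \<Longrightarrow>
      holds_list s' 13 a (ys @ cand_list (arr s 9) (stored_joined s) n j) \<Longrightarrow> t \<le> 5 * n + 4 \<Longrightarrow> Q t s'"
  shows "runs (write_cand a) s Q"
proof -
  define zs where "zs = (if j = 0 then ys else ys @ [arr s 9 (j - 1)])"
  let ?loop = "While (Less (Reg 10) (Reg 0))
      (Cond (Equal (Read 10 (Reg 10)) (Const 0))
         (Store a (Reg 13) (Read 9 (Reg 10)) ;; Assign 13 (Succ (Reg 13))) Skip ;;
       Assign 10 (Succ (Reg 10)))"
  have loop: "runs ?loop s' R"
    if s': "holds_list s' 13 a zs" "reg s' 0 = n" "reg s' 10 = j" "arr s' 9 = arr s 9" "arr s' 10 = arr s 10"
      and R: "\<And>t s''. holds_list s'' 13 a (zs @ map (arr s 9) (filter (\<lambda>k. \<not> stored_joined s k) [j..<n])) \<Longrightarrow>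
        t \<le> 5 * n + 1 \<Longrightarrow> R t s''" for s' R
  \<comment> \<open>\<open>max\<close> covers \<open>j > n\<close>, where the loop makes no round:
    if there is no kernel, counting calls this program on a cell of the candidate list about which
    nothing is known.\<close>
  proof (rule runs_While_up[where a = j and b = "max j n" and f = "\<lambda>_. 4"
        and I = "\<lambda>k s''. reg s'' 10 = k \<and>
          holds_list s'' 13 a (zs @ map (arr s 9) (filter (\<lambda>k. \<not> stored_joined s k) [j..<k]))"],
      goal_cases)
    case (3 k s'')
    have k: "k < n" using 3(1,2) by (simp add: less_max_iff_disj)
    define ws where "ws = zs @ map (arr s 9) (filter (\<lambda>k. \<not> stored_joined s k) [j..<k])"
    have I: "reg s'' 10 = k" "holds_list s'' 13 a ws" using 3(3) by (simp_all add: ws_def)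
    have same: "reg s'' 0 = n" "arr s'' 9 = arr s 9" "arr s'' 10 = arr s 10"
      using 3(4) a s' by (simp_all add: unchanged_def)
    have ws_Suc: "zs @ map (arr s 9) (filter (\<lambda>k. \<not> stored_joined s k) [j..<Suc k]) =
        (if stored_joined s k then ws else ws @ [arr s 9 k])"
      using 3(1) by (simp add: ws_def)
    show ?case
    proof (cases "stored_joined s k")
      case True
      then show ?thesis
        using I same k unfolding ws_Suc by (auto elim: holds_list_cong)
    next
      case False
      then show ?thesis
        using I same k unfolding ws_Suc by (auto elim: holds_list_append)
    qed
  next
    case (5 t s'')
    have "[j..<max j n] = [j..<n]" by (simp add: max_def)
    then show ?case using 5 by (intro R) simp_all
  qed (use s' in \<open>auto simp: unchanged_def\<close>)
  have cand: "ys @ cand_list (arr s 9) (stored_joined s) n j =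
      zs @ map (arr s 9) (filter (\<lambda>k. \<not> stored_joined s k) [j..<n])"
    by (simp add: cand_list_def zs_def)
  show ?thesis
  proof (rule runs_unchanged, cases "j = 0")
    case True
    show "runs (write_cand a) s (\<lambda>t s'. unchanged (write_cand a) s s' \<longrightarrow> Q t s')"
      unfolding write_cand_def
      by (simp add: s True, rule loop, unfold write_cand_def[symmetric])
        (use True s list cand in \<open>auto simp: zs_def intro!: post\<close>)
  next
    case False
    show "runs (write_cand a) s (\<lambda>t s'. unchanged (write_cand a) s s' \<longrightarrow> Q t s')"
      unfolding write_cand_def
      by (simp add: s False, rule loop, unfold write_cand_def[symmetric])
        (use False s list a cand in \<open>auto simp: zs_def intro!: post elim!: holds_list_append\<close>)
  qed
qed

context adjacency_lists
begin

lemma runs_build_sequence: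
  assumes n: "reg s 0 = n" and lists: "degree_lists_stored s"
    and post: "\<And>t s'. unchanged build_sequence s s' \<Longrightarrow>
      eliminates (arr s' 9) (stored_joined s') 0 \<Longrightarrow> t \<le> 8 * n + 4 \<Longrightarrow> Q t s'"
  shows "runs build_sequence s Q"
proof (rule runs_unchanged, unfold build_sequence_def runs_Seq[of "Assign _ (Const 0)"]
      runs_Seq[of "Assign _ (Reg 0)"] runs_Assign,
    rule runs_While_down[where b = n and f = "\<lambda>_. 7"
      and I = "\<lambda>r s'. reg s' 6 = r \<and> eliminates (arr s' 9) (stored_joined s') r
        \<and> reg s' 7 = dominating_after (stored_joined s') r \<and> reg s' 8 = r + reg s' 7
        \<and> degree_buckets (remaining (arr s' 9) r) (arr s' 7) (arr s 8)"],
    goal_cases)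
  case 1
  show ?case
    using n lists degree_buckets_bucketed[of n]
    by (simp add: eliminates_n degree_lists_stored_def remaining_def)
next
  case (2 r s')
  define x where "x = (if arr s' 7 (reg s' 7) = 0 then r + reg s' 7 else reg s' 7)"
  have nx: "arr s' 8 = arr s 8" using 2 by (simp add: unchanged_def)
  obtain v where v: "arr s' 7 x = Suc v" and
    step: "\<forall>joined'. (joined' r \<longleftrightarrow> arr s' 7 (reg s' 7) = 0) \<longrightarrow>
      (\<forall>k>r. joined' k = stored_joined s' k) \<longrightarrow>
      eliminates ((arr s' 9)(r := v)) joined' r \<and>
      degree_buckets (remaining ((arr s' 9)(r := v)) r) ((arr s' 7)(x := arr s 8 v)) (arr s 8) \<and>
      dominating_after joined' r = (if arr s' 7 (reg s' 7) = 0 then Suc (reg s' 7) else reg s' 7)"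
  proof (rule elimination_step)
    show "eliminates (arr s' 9) (stored_joined s') (Suc r)"
      "degree_buckets (remaining (arr s' 9) (Suc r)) (arr s' 7) (arr s 8)"
      "reg s' 7 = dominating_after (stored_joined s') (Suc r)"
      using 2(2) by simp_all
  qed (rule x_def)
  show ?case
  proof (cases "arr s' 7 (reg s' 7) = 0")
    case True
    \<comment> \<open>The instance of \<open>joined'\<close> is the simplified form of the flags
      after position \<open>r\<close> has been set to 1; the other case is the analogue for
      0.\<close>
    then show ?thesis
      using 2(2) nx v step[rule_format, of "\<lambda>k. k \<noteq> r \<longrightarrow> arr s' 10 k \<noteq> 0"] by (simp add: x_def)
  next
    case False
    then show ?thesis
      using 2(2) nx v step[rule_format, of "\<lambda>k. k \<noteq> r \<and> (k \<noteq> r \<longrightarrow> arr s' 10 k \<noteq> 0)"] by (simp add: x_def)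
  qed
next
  case (4 t s')
  then show ?case using post unfolding build_sequence_def[symmetric] by simp
qed simp

lemma runs_scan_earlier:
  assumes s: "reg s 10 = k" "reg s 11 = 0" "reg s 12 = 1" "reg s 2 = v"
    and marks: "\<forall>w. arr s 5 w = Suc v \<longleftrightarrow> A v w" "\<forall>w. arr s 6 w = Suc v \<longleftrightarrow> A w v"
    and post: "\<And>t s'. unchanged scan_earlier s s' \<Longrightarrow>
      (reg s' 11 \<noteq> 0 \<longleftrightarrow> (\<exists>w\<in>cand (arr s 9) (stored_joined s) 0 k. A v w)) \<Longrightarrow>
      (reg s' 12 \<noteq> 0 \<longleftrightarrow> (\<forall>p<k. A (arr s 9 p) v)) \<Longrightarrow>
      \<forall>i. arr s' 11 i \<noteq> 0 \<longleftrightarrow>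
        arr s 11 i \<noteq> 0 \<and> (0 < i \<and> i \<le> k \<longrightarrow> (\<exists>w\<in>cand (arr s 9) (stored_joined s) i k. A v w)) \<Longrightarrow>
      t \<le> 7 * k + 1 \<Longrightarrow> Q t s'"
  shows "runs scan_earlier s Q"
proof -
  let ?found = "\<lambda>j. \<exists>p. j \<le> p \<and> p < k \<and> \<not> stored_joined s p \<and> A v (arr s 9 p)"
  have found_Suc: "?found j \<longleftrightarrow> ?found (Suc j) \<or> (\<not> stored_joined s j \<and> A v (arr s 9 j))" if "j < k" for j
    using that by (metis Suc_le_eq le_eq_less_or_eq)
  \<comment> \<open>The criterion of the scan: an arc to the start of the candidate, or the bit
    already set above it.\<close>
  have cand_Suc: "(\<exists>w\<in>cand (arr s 9) (stored_joined s) (Suc j) k. A v w) \<longleftrightarrow> A v (arr s 9 j) \<or> ?found (Suc j)" for j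
    by (auto simp: cand_def)
  have range_Suc: "j < i \<and> i \<le> k \<longleftrightarrow> i = Suc j \<or> (Suc j < i \<and> i \<le> k)" if "j < k" for i j
    using that by auto
  show ?thesis
  proof (rule runs_unchanged, unfold scan_earlier_def, rule runs_While_down[where b = k and f = "\<lambda>_. 6"
        and I = "\<lambda>j s'. reg s' 10 = j \<and> (reg s' 11 \<noteq> 0 \<longleftrightarrow> ?found j)
          \<and> (reg s' 12 \<noteq> 0 \<longleftrightarrow> (\<forall>p. j \<le> p \<and> p < k \<longrightarrow> A (arr s 9 p) v))
          \<and> (\<forall>i. arr s' 11 i \<noteq> 0 \<longleftrightarrow>
            arr s 11 i \<noteq> 0 \<and> (j < i \<and> i \<le> k \<longrightarrow> (\<exists>w\<in>cand (arr s 9) (stored_joined s) i k. A v w)))"],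
      goal_cases)
    case (2 j s')
    have all: "(\<forall>p. j \<le> p \<and> p < k \<longrightarrow> A (arr s 9 p) v) \<longleftrightarrow>
        (\<forall>p. Suc j \<le> p \<and> p < k \<longrightarrow> A (arr s 9 p) v) \<and> A (arr s 9 j) v"
      using 2(1) by (metis Suc_le_eq le_eq_less_or_eq)
    have same: "reg s' 2 = v" "arr s' 5 = arr s 5" "arr s' 6 = arr s 6" "arr s' 9 = arr s 9" "arr s' 10 = arr s 10"
      using 2 s by (simp_all add: unchanged_def)
    \<comment> \<open>Opaque names make the rest a propositional claim for the case split
      below.\<close>
    define found where "found = ?found (Suc j)"
    define earlier_ok where "earlier_ok \<longleftrightarrow> (\<forall>p. Suc j \<le> p \<and> p < k \<longrightarrow> A (arr s 9 p) v)"
    define absorbs where "absorbs i \<longleftrightarrow> (\<exists>w\<in>cand (arr s 9) (stored_joined s) i k. A v w)" for i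
    have I: "reg s' 10 = Suc j" "0 < reg s' 11 \<longleftrightarrow> found" "0 < reg s' 12 \<longleftrightarrow> earlier_ok"
      "\<And>i. 0 < arr s' 11 i \<longleftrightarrow> 0 < arr s 11 i \<and> (Suc j < i \<and> i \<le> k \<longrightarrow> absorbs i)"
      using 2(2) unfolding found_def earlier_ok_def absorbs_def neq0_conv by blast+
    have "absorbs (Suc j) \<longleftrightarrow> A v (arr s 9 j) \<or> found"
      unfolding absorbs_def found_def by (rule cand_Suc)
    then show ?case
      using same marks I(1-3)
      unfolding found_Suc[OF 2(1)] all range_Suc[OF 2(1)]
      unfolding found_def[symmetric] earlier_ok_def[symmetric] absorbs_def[symmetric]
      by (cases "A v (arr s 9 j)"; cases "A (arr s 9 j) v"; cases "arr s 10 j = 0"; cases found)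
        (auto simp: I(4))
  next
    case (4 t s')
    then show ?case using post unfolding scan_earlier_def[symmetric] by (auto simp: cand_def)
  qed (use s in auto)
qed

lemma runs_process_dominating:
  assumes graph: "graph_stored s" and lists: "in_lists_stored s" and sound: "marks_sound s"
    and k: "reg s 9 = k" "k < n" "arr s 9 k < n" "stored_joined s k"
    and alive: "\<forall>i\<le>k. arr s 11 i \<noteq> 0 \<longleftrightarrow> alive A (arr s 9) (stored_joined s) i k"
    and post: "\<And>t s'. unchanged process_dominating s s' \<Longrightarrow> marks_sound s' \<Longrightarrow>
      \<forall>i\<le>Suc k. arr s' 11 i \<noteq> 0 \<longleftrightarrow> alive A (arr s 9) (stored_joined s) i (Suc k) \<Longrightarrow>
      t \<le> 4 * length (adj ! (arr s 9 k)) + 5 * length (in_list (arr s 9 k)) + 7 * k + 13 \<Longrightarrow> Q t s'"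
  shows "runs process_dominating s Q"
proof (rule runs_unchanged, unfold process_dominating_def runs_Seq runs_Assign,
    rule runs_mark_neighbours[where v = "arr s 9 k"], goal_cases)
  case (6 t s1)
  show ?case
  proof (rule runs_scan_earlier[where k = k and v = "arr s 9 k"], goal_cases)
    case (7 t' s2)
    have same: "arr s1 9 = arr s 9" "arr s1 10 = arr s 10" "arr s1 11 = arr s 11"
      "arr s2 9 = arr s 9" "reg s2 9 = k" "arr s2 5 = arr s1 5" "arr s2 6 = arr s1 6"
      using 6 7 k(1) by (auto simp: unchanged_def)
    \<comment> \<open>The states after the two closing commands, which settle candidate
      \<open>0\<close> and the new candidate \<open>Suc k\<close>.\<close>
    define s3 where "s3 = (if reg s2 11 = 0 then s2\<lparr>arr := (arr s2)(11 := (arr s2 11)(0 := 0))\<rparr> else s2)"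
    define s4 where "s4 = s3\<lparr>arr := (arr s3)(11 := (arr s3 11)(Suc k := reg s3 12))\<rparr>"
    have "arr s4 11 i \<noteq> 0 \<longleftrightarrow> alive A (arr s 9) (stored_joined s) i (Suc k)" if "i \<le> Suc k" for i
    proof (cases "i = Suc k")
      case True
      then show ?thesis using 7 k(4) same by (simp add: s4_def s3_def alive_new)
    next
      case False
      then show ?thesis
        using that 7 k(4) alive same by (cases "i = 0") (auto simp: s4_def s3_def alive_Suc)
    qed
    moreover have "marks_sound s4"
      using 6 same by (simp add: marks_sound_def s4_def s3_def)
    ultimately show ?case
      using 6 7 post[of s4] same unfolding process_dominating_def[symmetric]
      by (cases "reg s2 11 = 0") (auto simp: s4_def s3_def)
  qed (use 6 k in \<open>simp_all add: unchanged_def\<close>)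
qed (use assms in \<open>simp_all add: graph_stored_def in_lists_stored_def marks_sound_def\<close>)

end

context adjacency_lists
begin

lemma runs_find_alive:
  assumes graph: "graph_stored s" and lists: "in_lists_stored s" and sound: "marks_sound s"
    and seq: "construction_sequence n A (arr s 9) (stored_joined s)"
    and post: "\<And>t s'. unchanged find_alive s s' \<Longrightarrow>
      \<forall>i\<le>n. arr s' 11 i \<noteq> 0 \<longleftrightarrow> alive A (arr s 9) (stored_joined s) i n \<Longrightarrow>
      t \<le> 9 * arc_count + 7 * card edges + 16 * n + 3 \<Longrightarrow> Q t s'"
  shows "runs find_alive s Q"
proof -
  interpret construction_sequence n A "arr s 9" "stored_joined s" by (rule seq)
  show ?thesis
  proof (rule runs_unchanged, unfold find_alive_def runs_Seq[of "Assign _ (Const 0)"]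
      runs_Seq[of "Store _ _ _"] runs_Assign runs_Store,
      rule runs_While_up[where a = 0 and b = n
        and f = "\<lambda>k. 4 * length (adj ! (arr s 9 k)) + 5 * length (in_list (arr s 9 k)) +
          7 * (if stored_joined s k then k else 0) + 15"
        and I = "\<lambda>k s'. reg s' 9 = k \<and> marks_sound s' \<and>
          (\<forall>i\<le>k. arr s' 11 i \<noteq> 0 \<longleftrightarrow> alive A (arr s 9) (stored_joined s) i k)"],
      goal_cases)
    case (3 k s')
    have stored: "graph_stored s'" "in_lists_stored s'"
      using 3 graph lists by (simp_all add: unchanged_def graph_stored_def in_lists_stored_def)
    have same: "arr s' 9 = arr s 9" "arr s' 10 = arr s 10"
      using 3 by (simp_all add: unchanged_def)
    have test: "eval_test (Less (Reg 9) (Reg 0)) s'"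
      using stored(1) 3 by (simp add: graph_stored_def)
    show ?case
    proof (cases "stored_joined s k")
      case False
      have "alive A (arr s 9) (stored_joined s) i (Suc k) \<longleftrightarrow> alive A (arr s 9) (stored_joined s) i k"
        if "i \<le> k" for i
        using that False by (simp add: alive_Suc)
      moreover have "\<not> alive A (arr s 9) (stored_joined s) (Suc k) (Suc k)"
        using False by (simp add: alive_new)
      ultimately show ?thesis
        using test 3 same False by (auto simp: le_Suc_eq marks_sound_def)
    next
      case True
      have "runs process_dominating s' (\<lambda>t s''. reg s'' 9 = k \<and> marks_sound s'' \<and>
          (\<forall>i\<le>Suc k. arr s'' 11 i \<noteq> 0 \<longleftrightarrow> alive A (arr s 9) (stored_joined s) i (Suc k)) \<and>
          t \<le> 4 * length (adj ! (arr s 9 k)) + 5 * length (in_list (arr s 9 k)) + 7 * k + 13)"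
        by (rule runs_process_dominating[OF stored, where k = k])
          (use 3 same True ord_less[of k] in \<open>simp_all add: unchanged_def\<close>)
      then show ?thesis
        using test True same 3(3)
        by (auto elim!: runs_mono simp: marks_sound_def)
    qed
  next
    case (5 t s')
    \<comment> \<open>Each vertex occupies one position, so summing list lengths along the sequence
      counts each arc once.\<close>
    have "(\<Sum>k<n. length (adj ! arr s 9 k)) = arc_count"
      using sum.reindex_bij_betw[OF bij, of "\<lambda>u. length (adj ! u)"] sum_out by simp
    moreover have "(\<Sum>k<n. length (in_list (arr s 9 k))) = arc_count"
      using sum.reindex_bij_betw[OF bij, of "\<lambda>u. length (in_list u)"] sum_in by simp
    moreover have "(\<Sum>k<n. 7 * (if stored_joined s k then k else 0)) \<le> 7 * card edges"
      using sum_dominating_le_edges by (simp only: sum_distrib_left[symmetric])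
    moreover have "t \<le> (\<Sum>k<n. 4 * length (adj ! (arr s 9 k))) + (\<Sum>k<n. 5 * length (in_list (arr s 9 k))) +
        (\<Sum>k<n. 7 * (if stored_joined s k then k else 0)) + (\<Sum>k<n. 16) + 1"
      using 5(3) by (simp only: sum.distrib[symmetric] atLeast0LessThan) (simp add: add.assoc)
    ultimately have "t \<le> 9 * arc_count + 7 * card edges + 16 * n + 1"
      by (simp only: sum_distrib_left[symmetric]) simp
    then show ?case
      using 5 post unfolding find_alive_def[symmetric] by simp
  qed (use graph sound in \<open>auto simp: unchanged_def graph_stored_def marks_sound_def\<close>)
qed

lemma runs_list_alive:
  assumes s: "reg s 0 = n" and alive: "\<forall>i\<le>n. arr s 11 i \<noteq> 0 \<longleftrightarrow> alive A ord joined i n"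
    and post: "\<And>t s'. unchanged list_alive s s' \<Longrightarrow> holds_list s' 14 12 (alive_list A ord joined n) \<Longrightarrow>
      t \<le> 5 * n + 8 \<Longrightarrow> Q t s'"
  shows "runs list_alive s Q"
proof (rule runs_unchanged, unfold list_alive_def runs_Seq[of "Assign _ (Const 0)"] runs_Assign,
    rule runs_While_up[where a = 0 and b = "Suc n" and f = "\<lambda>_. 4"
      and I = "\<lambda>j s'. reg s' 10 = j \<and> holds_list s' 14 12 (filter (\<lambda>j. alive A ord joined j n) [0..<j])"],
    goal_cases)
  case (3 j s')
  define ws where "ws = filter (\<lambda>j. alive A ord joined j n) [0..<j]"
  have I: "reg s' 10 = j" "holds_list s' 14 12 ws" using 3(3) by (simp_all add: ws_def)
  have same: "reg s' 0 = n" "arr s' 11 = arr s 11"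
    using 3(4) s by (simp_all add: unchanged_def)
  have ws_Suc: "filter (\<lambda>j. alive A ord joined j n) [0..<Suc j] =
      (if alive A ord joined j n then ws @ [j] else ws)"
    by (simp add: ws_def)
  have "arr s 11 j \<noteq> 0 \<longleftrightarrow> alive A ord joined j n" "j \<le> n" using alive 3(2) by simp_all
  then show ?case
    unfolding ws_Suc using I same
    by (cases "alive A ord joined j n") (auto elim: holds_list_append holds_list_cong)
next
  case (5 t s')
  then show ?case
    using post unfolding list_alive_def[symmetric] by (simp add: alive_list_def)
qed (use s in \<open>simp_all add: holds_list_def unchanged_def\<close>)

lemma runs_solve:
  assumes post: "\<And>t s'. reg s' 0 = n \<Longrightarrow> construction_sequence n A (arr s' 9) (stored_joined s') \<Longrightarrow>
      holds_list s' 14 12 (alive_list A (arr s' 9) (stored_joined s') n) \<Longrightarrow>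
      t \<le> 23 * arc_count + 7 * card edges + 41 * n + 20 \<Longrightarrow> Q t s'"
  shows "runs solve (input_store adj) Q"
  unfolding solve_def runs_Seq
proof (rule runs_build_in_lists[OF graph_stored_input], goal_cases)
  case 1
  show ?case by (simp add: input_store_def)
next
  case (2 t1 s1)
  have "graph_stored s1"
    using 2(1) graph_stored_input by (simp add: unchanged_def graph_stored_def)
  moreover have "marks_sound s1" "\<forall>d. arr s1 7 d = 0"
    using 2(1) by (simp_all add: unchanged_def marks_sound_def input_store_def)
  ultimately have s1: "graph_stored s1" "marks_sound s1" "\<forall>d. arr s1 7 d = 0" .
  show ?case
  proof (rule runs_build_degree_lists[OF s1(1) 2(2) s1(2,3)], goal_cases)
    case (1 t2 s2)
    have s2: "graph_stored s2" "in_lists_stored s2"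
      using 1(1) s1(1) 2(2) by (simp_all add: unchanged_def graph_stored_def in_lists_stored_def)
    show ?case
    proof (rule runs_build_sequence[OF _ 1(3)], goal_cases)
      case 1
      show ?case using s2 by (simp add: graph_stored_def)
    next
      case (2 t3 s3)
      have s3: "graph_stored s3" "in_lists_stored s3" "marks_sound s3"
        using 2(1) s2 1(2) by (simp_all add: unchanged_def graph_stored_def in_lists_stored_def marks_sound_def)
      have seq: "construction_sequence n A (arr s3 9) (stored_joined s3)"
        using 2(2) by (rule construction_sequenceI)
      show ?case
      proof (rule runs_find_alive[OF s3 seq], goal_cases)
        case (1 t4 s4)
        show ?case
        proof (rule runs_list_alive[OF _ 1(2)], goal_cases)
          case 1
          show ?case using \<open>unchanged find_alive s3 s4\<close> s3 by (simp add: unchanged_def graph_stored_def)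
        next
          case (2 t5 s5)
          have "arr s5 9 = arr s3 9" "arr s5 10 = arr s3 10" "reg s5 0 = n"
            using 2(1) 1(1) s3(1) by (simp_all add: unchanged_def graph_stored_def)
          then show ?case
            using seq 2 \<open>t4 \<le> _\<close> \<open>t3 \<le> _\<close> \<open>t2 \<le> _\<close> \<open>t1 \<le> _\<close> by (intro post) simp_all
        qed
      qed
    qed
  qed
qed

lemma runs_count_kernels:
  assumes post: "\<And>t s ord joined. construction_sequence n A ord joined \<Longrightarrow>
      reg s 0 = length (alive_list A ord joined n) \<Longrightarrow>
      (alive_list A ord joined n \<noteq> [] \<longrightarrow>
        holds_list s 1 0 (cand_list ord joined n (hd (alive_list A ord joined n)))) \<Longrightarrow>
      t \<le> 23 * arc_count + 7 * card edges + 46 * n + 28 \<Longrightarrow> Q t s"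
  shows "runs count_kernels (input_store adj) Q"
  unfolding count_kernels_def runs_Seq runs_Assign
proof (rule runs_solve, goal_cases)
  case (1 t s)
  let ?js = "alive_list A (arr s 9) (stored_joined s) n"
  show ?case
  proof (rule runs_write_cand[where n = n and ys = "[]" and j = "arr s 12 0"], goal_cases)
    case (6 t' s')
    have js: "length ?js = reg s' 14"
      using 6(1) 1(3) by (simp add: unchanged_def holds_list_def)
    have "holds_list s' 13 0 (cand_list (arr s 9) (stored_joined s) n (hd ?js))" if "?js \<noteq> []"
      using that 6(2) 1(3) by (simp add: holds_list_def hd_conv_nth)
    then show ?case
      using 1 6(3) js by (intro post[OF 1(2)]) (simp_all add: holds_list_def)
  qed (use 1 in \<open>simp_all add: holds_list_def\<close>)
qed

lemma runs_enumerate_kernels: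
  assumes post: "\<And>t s ord joined. construction_sequence n A ord joined \<Longrightarrow>
      holds_lists s 0 0 1 (map (cand_list ord joined n) (alive_list A ord joined n)) \<Longrightarrow>
      t \<le> 23 * arc_count + 7 * card edges + 41 * n + 25 +
        length (alive_list A ord joined n) * (5 * n + 8) \<Longrightarrow> Q t s"
  shows "runs enumerate_kernels (input_store adj) Q"
  unfolding enumerate_kernels_def runs_Seq[of solve] runs_Seq[of "Assign _ (Const 0)"] runs_Assign
proof (rule runs_solve, goal_cases)
  case (1 t s)
  define js where "js = alive_list A (arr s 9) (stored_joined s) n"
  define xss where "xss = map (cand_list (arr s 9) (stored_joined s) n) js"
  define written where "written = (\<lambda>i s'. reg s' 15 = i \<and> holds_list s' 13 1 (concat (take i xss))
    \<and> (\<forall>k<i. arr s' 0 k = length (concat (take k xss))))"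
  have js: "reg s 14 = length xss" "\<And>i. i < length xss \<Longrightarrow> arr s 12 i = js ! i"
    using 1(3) by (simp_all add: holds_list_def js_def xss_def)
  show ?case
    unfolding runs_Seq[of "While _ _"]
  proof (rule runs_While_up[where a = 0 and b = "length xss" and f = "\<lambda>_. 5 * n + 7" and I = written],
      goal_cases)
    case (3 i s')
    have same: "reg s' 0 = n" "reg s' 14 = length xss" "arr s' 12 = arr s 12" "arr s' 9 = arr s 9"
        "arr s' 10 = arr s 10"
      using 3(4) 1(1) js by (simp_all add: unchanged_def)
    have list: "holds_list s' 13 1 (concat (take i xss))" and i: "reg s' 15 = i"
      using 3(3) by (simp_all add: written_def)
    have take: "concat (take (Suc i) xss) =
        concat (take i xss) @ cand_list (arr s 9) (stored_joined s) n (js ! i)"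
      using 3(2) by (simp add: take_Suc_conv_app_nth xss_def)
    show ?case
      unfolding runs_Seq runs_Store runs_Assign
    proof (intro conjI, goal_cases)
      case 1
      show ?case using i same 3(2) by simp
    next
      case 2
      show ?case
      proof (rule runs_write_cand[where n = n and ys = "concat (take i xss)" and j = "js ! i"], goal_cases)
        case (6 t' s'')
        have "arr s'' 0 = (arr s' 0)(i := length (concat (take i xss)))" "reg s'' 15 = i"
          using 6(1) i list by (simp_all add: unchanged_def holds_list_def)
        then show ?case
          using 6(2,3) 3(3) same take by (auto simp: written_def holds_list_def less_Suc_eq)
      qed (use list i same js 3(2) in \<open>simp_all add: holds_list_def\<close>)
    qed
  next
    case (4 s')
    then show ?case using js by (simp add: unchanged_def written_def)
  next
    case (5 t' s')
    then have w: "written (length xss) s'" by simp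
    have "reg s' 14 = length xss" using 5(2) js by (simp add: unchanged_def)
    then show ?case
      using w 1(4) 5(3)
      by (auto intro!: post[OF 1(2)] simp: written_def holds_lists_def holds_list_def xss_def js_def
        le_less algebra_simps)
  qed (simp_all add: written_def holds_list_def)
qed

end

text \<open>
  For arbitrary \<open>S\<close>, since any isolated or dominating vertex may be the one that is eliminated.
\<close>

lemma threshold_isolated_or_dominating:
  assumes "threshold_graph V E" "S \<subseteq> V" "S \<noteq> {}"
  shows "\<exists>v\<in>S. (\<forall>u\<in>S. {u, v} \<notin> E) \<or> (\<forall>u\<in>S - {v}. {u, v} \<in> E)"
proof -
  have edges: "\<Union>E \<subseteq> V" if "threshold_graph V E" for V and E :: "'a set set"
    using that by (induction rule: threshold_graph.induct) auto
  show ?thesis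
    using assms
  proof (induction rule: threshold_graph.induct)
    case (single v)
    then show ?case by auto
  next
    case (isolated V E v)
    show ?case
    proof (cases "v \<in> S")
      case True
      then show ?thesis using edges[OF isolated.hyps(1)] isolated.hyps(2) by blast
    next
      case False
      then show ?thesis using isolated.IH isolated.prems by blast
    qed
  next
    case (dominating V E v)
    show ?case
    proof (cases "v \<in> S")
      case True
      then show ?thesis using dominating.prems by (intro bexI[of _ v]) auto
    next
      case False
      then have S: "S \<subseteq> V" using dominating.prems by blast
      then obtain w where w: "w \<in> S" "(\<forall>u\<in>S. {u, w} \<notin> E) \<or> (\<forall>u\<in>S - {w}. {u, w} \<in> E)"
        using dominating.IH dominating.prems by blast
      have "{u, w} \<notin> {{u, v} |u. u \<in> V}" if "u \<in> S" for u
        using False that w(1) by (auto simp: doubleton_eq_iff)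
      then show ?thesis using w by blast
    qed
  qed
qed

section \<open>From digraphs to adjacency lists, and the final bounds\<close>

lemma adjacency_lists_digraph:
  assumes "pair_digraph T" "threshold_graph (pverts T) (underlying_edges T)" "out_lists T adj"
  shows "adjacency_lists (length adj) (\<lambda>u v. (u, v) \<in> parcs T) adj"
proof -
  interpret pair_digraph T by (rule assms(1))
  have V: "pverts T = {..<length adj}" using assms(3) by (simp add: out_lists_def)
  interpret finite_digraph "length adj" "\<lambda>u v. (u, v) \<in> parcs T"
    by unfold_locales (use in_arcsD1 in_arcsD2 no_loops V in fastforce)+
  show ?thesis
  proof unfold_locales
    fix S assume "S \<subseteq> {..<length adj}" "S \<noteq> {}"
    moreover have "{u, v} \<in> underlying_edges T \<longleftrightarrow> adjacent u v" for u v
      using edge_iff_adjacent by (simp add: edges_def underlying_edges_def)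
    ultimately show "\<exists>v\<in>S. (\<forall>u\<in>S. \<not> adjacent u v) \<or> (\<forall>u\<in>S - {v}. adjacent u v)"
      using threshold_isolated_or_dominating[OF assms(2), of S] V by simp
  qed (use assms(3) in \<open>auto simp: out_lists_def\<close>)
qed

lemma clique_number_ge:
  assumes "finite V" "C \<subseteq> V" "\<And>u v. u \<in> C \<Longrightarrow> v \<in> C \<Longrightarrow> u \<noteq> v \<Longrightarrow> {u, v} \<in> E"
  shows "card C \<le> clique_number V E"
  unfolding clique_number_def
  by (rule Max_ge) (use assms in \<open>auto intro!: imageI finite_imageI\<close>)

theorem theorem19:
  shows "(\<exists>p c. \<forall>T adj. pair_digraph T \<longrightarrow>
            threshold_graph (pverts T) (underlying_edges T) \<longrightarrow> out_lists T adj \<longrightarrow>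
            (\<exists>t s. exec p (input_store adj) t s \<and> t \<le> c * total_size T \<and>
                   kernel_counted_and_built T s))
       \<and> (\<exists>p c. \<forall>T adj. pair_digraph T \<longrightarrow>
            threshold_graph (pverts T) (underlying_edges T) \<longrightarrow> out_lists T adj \<longrightarrow>
            (\<exists>t s. exec p (input_store adj) t s \<and> t \<le> c * (omega T * order T + total_size T) \<and>
                   kernels_enumerated T s))"
proof -
  \<comment> \<open>Since \<open>arc_count \<le> 2 * card edges\<close>, an edge costs at most 23 *
    2 + 7 = 53. With additive constants absorbed by \<open>1 \<le> n\<close>, a vertex costs at most
    74 for counting and 79 for enumerating, the latter besides \<open>13 * omega T * n\<close>. So
    100 is ample.\<close>
  have "runs count_kernels (input_store adj) (\<lambda>t s. t \<le> 100 * total_size T \<and> kernel_counted_and_built T s) \<and>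
      runs enumerate_kernels (input_store adj)
        (\<lambda>t s. t \<le> 100 * (omega T * order T + total_size T) \<and> kernels_enumerated T s)"
    if "pair_digraph T" "threshold_graph (pverts T) (underlying_edges T)" "out_lists T adj" for T adj
  proof -
    define n where "n = length adj"
    define A where "A = (\<lambda>u v. (u, v) \<in> parcs T)"
    interpret adjacency_lists n A adj
      unfolding n_def A_def using that by (rule adjacency_lists_digraph)
    have V: "pverts T = {..<n}" using that(3) by (simp add: out_lists_def n_def)
    have E: "underlying_edges T = edges" unfolding edges_def underlying_edges_def by (simp add: A_def)
    have size: "total_size T = n + card edges" "order T = n"
      by (simp_all add: total_size_def order_def V E)
    \<comment> \<open>Threshold graphs have a vertex; without one, the additive constants could not
      be bounded by a multiple of the size.\<close>
    have "pverts T \<noteq> {}" using that(2) by (induction rule: threshold_graph.induct) auto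
    then have n: "1 \<le> n" using V by (cases n) auto
    \<comment> \<open>\<open>is_kernel\<close> depends on \<open>n\<close> and \<open>A\<close>
      only, so it can be identified with \<open>kernel T\<close> whatever sequence the program
      finds.\<close>
    have is_kernel: "construction_sequence.is_kernel n A = kernel T"
      if "construction_sequence n A ord joined" for ord joined
    proof -
      interpret construction_sequence n A ord joined by (rule that)
      show ?thesis
        by (auto simp: fun_eq_iff is_kernel_def kernel_def V E edge_iff_adjacent) (auto simp: A_def)
    qed
    show ?thesis
    proof (intro conjI)
      show "runs count_kernels (input_store adj) (\<lambda>t s. t \<le> 100 * total_size T \<and> kernel_counted_and_built T s)"
      proof (rule runs_count_kernels, goal_cases)
        case (1 t s ord joined)
        interpret construction_sequence n A ord joined by (rule 1(1))
        note kernels = kernels_eq[unfolded is_kernel[OF 1(1)]]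
        have "\<exists>xs. holds_list s 1 0 xs \<and> distinct xs \<and> kernel T (set xs)" if "kernel T K" for K
        proof -
          define j where "j = hd (alive_list A ord joined n)"
          have ne: "alive_list A ord joined n \<noteq> []" using that kernels by fastforce
          then have j: "j \<in> set (alive_list A ord joined n)" unfolding j_def by (rule hd_in_set)
          then have "kernel T (cand ord joined j n)" using kernels by blast
          then show ?thesis
            using 1(3) ne j distinct_cand_list[of j] by (intro exI[of _ "cand_list ord joined n j"]) (simp add: j_def)
        qed
        then have "kernel_counted_and_built T s"
          using 1(2) card_kernels[unfolded is_kernel[OF 1(1)]] by (auto simp: kernel_counted_and_built_def)
        then show ?case using 1(4) arc_count_le n size by simp
      qed
      show "runs enumerate_kernels (input_store adj)
          (\<lambda>t s. t \<le> 100 * (omega T * order T + total_size T) \<and> kernels_enumerated T s)"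
      proof (rule runs_enumerate_kernels, goal_cases)
        case (1 t s ord joined)
        interpret construction_sequence n A ord joined by (rule 1(1))
        note kernels = kernels_eq[unfolded is_kernel[OF 1(1)]]
        let ?js = "alive_list A ord joined n"
        have "distinct (map set (map (cand_list ord joined n) ?js))"
          using inj_cand distinct_alive_list by (simp add: distinct_map comp_def)
        moreover have "set (map set (map (cand_list ord joined n) ?js)) = {K. kernel T K}"
          unfolding kernels by (simp add: image_image)
        moreover have "\<forall>xs\<in>set (map (cand_list ord joined n) ?js). distinct xs"
          using distinct_cand_list by auto
        ultimately have "kernels_enumerated T s"
          unfolding kernels_enumerated_def using 1(2) by blast
        have "card (ord ` {k. k < n \<and> joined k}) \<le> omega T"
          unfolding omega_def V E
          by (rule clique_number_ge) (use ord_less dominating_clique in \<open>auto simp: edge_iff_adjacent\<close>)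
        moreover have "card (ord ` {k. k < n \<and> joined k}) = card {k. k < n \<and> joined k}"
          by (rule card_image) (auto simp: inj_on_def ord_eq_iff)
        ultimately have "length ?js \<le> Suc (omega T)" using length_alive_list_le by simp
        \<comment> \<open>13 = 5 + 8, using \<open>1 \<le> n\<close>; the \<open>Suc\<close> yields
          an extra \<open>13 * n\<close>, which \<open>total_size T\<close> covers.\<close>
        then have "length ?js * (5 * n + 8) \<le> Suc (omega T) * (13 * n)"
          using n by (intro mult_mono) auto
        then show ?case
          using \<open>kernels_enumerated T s\<close> 1(3) arc_count_le n size by (simp add: algebra_simps)
      qed
    qed
  qed
  then show ?thesis unfolding runs_def by meson
qed

end
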